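(* Let $\lambda=(A,B,C)$ with $A\ge B\ge C\ge0$ be a Young diagram with at most three rows. Then for every finite field $\mathbb F_q$ of characteristic $p$, with $W(\mathbb F_q)$ the ring of Witt vectors of $\mathbb F_q$, $$\mathscr H^{inst}_\lambda(q,t,0)=\mathbb H^{inst}_\lambda(q,t,0).$$ Explicitly, $$\sum_{I_\lambda\subset I\subset\mathbb F_q[[x,y]]}t^{\dim_{\mathbb F_q}(\mathbb F_q[[x,y]]/I)}=\sum_{\mathbb I_\lambda\subset\mathbb I\subset W(\mathbb F_q)[[x]]}t^{\log_q|W(\mathbb F_q)[[x]]/\mathbb I|},$$ where the sums are over ideals $I$ of $\mathbb F_q[[x,y]]$ containing $I_\lambda$ and ideals $\mathbb I$ of $W(\mathbb F_q)[[x]]$ containing $\mathbb I_\lambda$, respectively.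
   Context: $I_\lambda=(x^3,\ x^2y^C,\ xy^B,\ y^A)\subset\mathbb F_q[[x,y]]$ and $\mathbb I_\lambda=(x^3,\ p^Cx^2,\ p^Bx,\ p^A)\subset W(\mathbb F_q)[[x]]$. The polynomials $\mathscr H^{inst}_\lambda(q,t,0)$ and $\mathbb H^{inst}_\lambda(q,t,0)$ are, by definition, the left-hand and right-hand sums in the explicit formula. *)

theory Defs
  imports Complex_Main "HOL-Library.Poly_Mapping" "HOL-Library.Cardinality"
    "HOL-Computational_Algebra.Computational_Algebra"
begin

section \<open>Polynomials over the integers in arbitrarily many variables\<close>

text \<open>
  A monomial is its finitely supported exponent function; a polynomial is a finitely supported
  function from monomials to coefficients.
\<close>

type_synonym 'v zpoly = "('v \<Rightarrow>\<^sub>0 nat) \<Rightarrow>\<^sub>0 int"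

definition zvar :: "'v \<Rightarrow> 'v zpoly" where
  "zvar v = Poly_Mapping.single (Poly_Mapping.single v 1) 1"

definition meval :: "('v \<Rightarrow> 'r::comm_ring_1) \<Rightarrow> ('v \<Rightarrow>\<^sub>0 nat) \<Rightarrow> 'r" where
  "meval e m = (\<Prod>v\<in>Poly_Mapping.keys m. e v ^ Poly_Mapping.lookup m v)"

definition zeval :: "('v \<Rightarrow> 'r::comm_ring_1) \<Rightarrow> 'v zpoly \<Rightarrow> 'r" where
  "zeval e f = (\<Sum>m\<in>Poly_Mapping.keys f. of_int (Poly_Mapping.lookup f m) * meval e m)"

lemma meval_superset:
  assumes "finite K" "Poly_Mapping.keys m \<subseteq> K"
  shows "meval e m = (\<Prod>v\<in>K. e v ^ Poly_Mapping.lookup m v)"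
  unfolding meval_def
  by (rule prod.mono_neutral_left) (use assms in \<open>auto simp: in_keys_iff\<close>)

lemma meval_add: "meval e (m + n) = meval e m * meval e n"
proof -
  let ?K = "Poly_Mapping.keys m \<union> Poly_Mapping.keys n"
  have "meval e (m + n) = (\<Prod>v\<in>?K. e v ^ Poly_Mapping.lookup (m + n) v)"
    by (rule meval_superset) (use Poly_Mapping.keys_add[of m n] in auto)
  moreover have "meval e m = (\<Prod>v\<in>?K. e v ^ Poly_Mapping.lookup m v)"
    by (rule meval_superset) auto
  moreover have "meval e n = (\<Prod>v\<in>?K. e v ^ Poly_Mapping.lookup n v)"
    by (rule meval_superset) auto
  ultimately show ?thesis
    by (simp add: lookup_add power_add prod.distrib)
qed

lemma meval_0 [simp]: "meval e 0 = 1"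
  by (simp add: meval_def)

lemma zeval_superset:
  assumes "finite K" "Poly_Mapping.keys f \<subseteq> K"
  shows "zeval e f = (\<Sum>m\<in>K. of_int (Poly_Mapping.lookup f m) * meval e m)"
  unfolding zeval_def
  by (rule sum.mono_neutral_left) (use assms in \<open>auto simp: in_keys_iff\<close>)

lemma zeval_0 [simp]: "zeval e 0 = 0"
  by (simp add: zeval_def)

lemma zeval_frag_of [simp]: "zeval e (frag_of m) = meval e m"
  by (simp add: zeval_def)

lemma zeval_add: "zeval e (f + g) = zeval e f + zeval e g"
proof -
  let ?K = "Poly_Mapping.keys f \<union> Poly_Mapping.keys g"
  have "zeval e (f + g) = (\<Sum>v\<in>?K. of_int (Poly_Mapping.lookup (f + g) v) * meval e v)"
    by (rule zeval_superset) (use Poly_Mapping.keys_add[of f g] in auto)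
  moreover have "zeval e f = (\<Sum>v\<in>?K. of_int (Poly_Mapping.lookup f v) * meval e v)"
    by (rule zeval_superset) auto
  moreover have "zeval e g = (\<Sum>v\<in>?K. of_int (Poly_Mapping.lookup g v) * meval e v)"
    by (rule zeval_superset) auto
  ultimately show ?thesis
    by (simp add: lookup_add distrib_right sum.distrib)
qed

lemma zeval_uminus: "zeval e (- f) = - zeval e f"
  using zeval_add[of e f "- f"] by (simp add: eq_neg_iff_add_eq_0 add.commute)

lemma zeval_diff: "zeval e (f - g) = zeval e f - zeval e g"
  using zeval_add[of e f "- g"] by (simp add: zeval_uminus)

lemma zpoly_induct [case_names zero mono diff]:
  fixes f :: "'v zpoly"
  assumes "P 0" "\<And>m. P (frag_of m)" "\<And>f g. P f \<Longrightarrow> P g \<Longrightarrow> P (f - g)"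
  shows "P f"
  by (rule frag_induction[of f UNIV]) (use assms in auto)

lemma frag_of_mult: "frag_of (m::'v \<Rightarrow>\<^sub>0 nat) * frag_of n = frag_of (m + n)"
  by (simp add: mult_single)

lemma zeval_mult: "zeval e (f * g) = zeval e f * zeval e g"
proof (induction f rule: zpoly_induct)
  case (mono m)
  show ?case
  proof (induction g rule: zpoly_induct)
    case (mono n)
    show ?case by (simp only: frag_of_mult zeval_frag_of meval_add)
  qed (simp_all add: zeval_diff right_diff_distrib)
qed (simp_all add: zeval_diff left_diff_distrib)

lemma zeval_1 [simp]: "zeval e 1 = 1"
  using zeval_frag_of[of e 0] by (simp del: zeval_frag_of)

lemma zeval_power: "zeval e (f ^ n) = zeval e f ^ n"
  by (induction n) (simp_all add: zeval_mult)

lemma zeval_sum: "zeval e (\<Sum>i\<in>I. f i) = (\<Sum>i\<in>I. zeval e (f i))"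
  by (induction I rule: infinite_finite_induct) (simp_all add: zeval_add)

lemma zeval_of_nat: "zeval e (of_nat n) = of_nat n"
  by (induction n) (simp_all add: zeval_add)

lemma zeval_zvar [simp]: "zeval e (zvar v) = e v"
  unfolding zvar_def by (simp add: zeval_def meval_def)

lemma zpoly_torsion_free:
  fixes f g :: "'v zpoly"
  assumes "of_nat n * f = of_nat n * g" "n > 0"
  shows "f = g"
proof (rule poly_mapping_eqI)
  fix k
  have *: "Poly_Mapping.lookup (of_nat n * h) k = int n * Poly_Mapping.lookup h k" for h :: "'v zpoly"
    by (induction n) (simp_all add: lookup_add distrib_right)
  from assms * show "Poly_Mapping.lookup f k = Poly_Mapping.lookup g k"
    by (metis mult_cancel_left of_nat_0_less_iff less_irrefl)
qed

section \<open>Ghost components\<close>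

definition ghost :: "nat \<Rightarrow> (nat \<Rightarrow> 'r::comm_ring_1) \<Rightarrow> nat \<Rightarrow> 'r" where
  "ghost p a n = (\<Sum>i\<le>n. of_nat (p ^ i) * a i ^ (p ^ (n - i)))"

text \<open>
  The unique sequence of integral polynomials with prescribed ghost components. It exists for the
  three sequences used below (lemma \<open>ghost_witt_polys\<close>).
\<close>

definition witt_polys :: "nat \<Rightarrow> (nat \<Rightarrow> 'v zpoly) \<Rightarrow> nat \<Rightarrow> 'v zpoly" where
  "witt_polys p g = (THE S. \<forall>n. ghost p S n = g n)"

text \<open>The variable \<open>(0, i)\<close> plays the role of $X_i$ and \<open>(1, i)\<close> that of $Y_i$.\<close>

abbreviation witt_X :: "nat \<Rightarrow> nat \<Rightarrow> (nat \<times> nat) zpoly" where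
  "witt_X j \<equiv> (\<lambda>i. zvar (j, i))"

definition witt_add_poly :: "nat \<Rightarrow> nat \<Rightarrow> (nat \<times> nat) zpoly" where
  "witt_add_poly p = witt_polys p (\<lambda>n. ghost p (witt_X 0) n + ghost p (witt_X 1) n)"

definition witt_mult_poly :: "nat \<Rightarrow> nat \<Rightarrow> (nat \<times> nat) zpoly" where
  "witt_mult_poly p = witt_polys p (\<lambda>n. ghost p (witt_X 0) n * ghost p (witt_X 1) n)"

definition witt_neg_poly :: "nat \<Rightarrow> nat \<Rightarrow> (nat \<times> nat) zpoly" where
  "witt_neg_poly p = witt_polys p (\<lambda>n. - ghost p (witt_X 0) n)"

definition witt_subst :: "(nat \<Rightarrow> 'r) \<Rightarrow> (nat \<Rightarrow> 'r) \<Rightarrow> nat \<times> nat \<Rightarrow> 'r" where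
  "witt_subst a b = (\<lambda>(j, i). if j = 0 then a i else b i)"

definition wadd :: "nat \<Rightarrow> (nat \<Rightarrow> 'r::comm_ring_1) \<Rightarrow> (nat \<Rightarrow> 'r) \<Rightarrow> nat \<Rightarrow> 'r" where
  "wadd p a b n = zeval (witt_subst a b) (witt_add_poly p n)"

definition wmult :: "nat \<Rightarrow> (nat \<Rightarrow> 'r::comm_ring_1) \<Rightarrow> (nat \<Rightarrow> 'r) \<Rightarrow> nat \<Rightarrow> 'r" where
  "wmult p a b n = zeval (witt_subst a b) (witt_mult_poly p n)"

definition wneg :: "nat \<Rightarrow> (nat \<Rightarrow> 'r::comm_ring_1) \<Rightarrow> nat \<Rightarrow> 'r" where
  "wneg p a n = zeval (witt_subst a (\<lambda>_. 0)) (witt_neg_poly p n)"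

definition wone :: "nat \<Rightarrow> 'r::comm_ring_1" where
  "wone n = (if n = 0 then 1 else 0)"

section \<open>Existence of the Witt polynomials\<close>

definition zfrob :: "nat \<Rightarrow> 'v zpoly \<Rightarrow> 'v zpoly" where
  "zfrob p = zeval (\<lambda>v. zvar v ^ p)"

lemma dvd_add_power_prime:
  fixes a b :: "'r::comm_ring_1"
  assumes "prime p"
  shows "of_nat p dvd (a + b) ^ p - (a ^ p + b ^ p)"
proof -
  have p: "p > 0" using assms by (simp add: prime_gt_0_nat)
  let ?f = "\<lambda>k. of_nat (p choose k) * a ^ k * b ^ (p - k)"
  have "(a + b) ^ p = (\<Sum>k\<le>p. ?f k)" by (rule binomial_ring)
  also have "{..p} = insert 0 (insert p {0<..<p})" using p by auto
  also have "sum ?f \<dots> = b ^ p + (a ^ p + sum ?f {0<..<p})" using p by simp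
  finally have *: "(a + b) ^ p - (a ^ p + b ^ p) = sum ?f {0<..<p}" by (simp add: algebra_simps)
  have "of_nat p dvd ?f k" if "k \<in> {0<..<p}" for k
  proof -
    have "p dvd (p choose k)" using assms that by (intro dvd_choose_prime) auto
    then have "(of_nat p :: 'r) dvd of_nat (p choose k)" by (elim dvdE) simp
    then show ?thesis by (simp add: mult.assoc)
  qed
  then show ?thesis unfolding * by (rule dvd_sum)
qed

lemma meval_power: "meval (\<lambda>v. e v ^ n) m = meval e m ^ n"
  by (simp add: meval_def prod_power_distrib flip: power_mult) (simp add: mult.commute)

lemma zvar_power: "zvar v ^ n = frag_of (Poly_Mapping.single v n)"
proof (induction n)
  case (Suc n)
  then show ?case by (simp add: zvar_def mult_single flip: single_add)
qed simp

lemma meval_zvar: "meval zvar m = frag_of m"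
proof -
  have "(\<Prod>v\<in>K. zvar v ^ k v) = frag_of (\<Sum>v\<in>K. Poly_Mapping.single v (k v))"
    if "finite K" for K and k :: "'a \<Rightarrow> nat"
    using that by (induction K) (simp_all add: zvar_power mult_single)
  moreover have "m = (\<Sum>v\<in>Poly_Mapping.keys m. Poly_Mapping.single v (Poly_Mapping.lookup m v))"
    by (rule poly_mapping_eqI)
       (auto simp: lookup_sum lookup_single in_keys_iff when_def)
  ultimately show ?thesis
    unfolding meval_def by (metis finite_keys)
qed

lemma zfrob_cong:
  assumes "prime p"
  shows "of_nat p dvd zfrob p f - f ^ p"
proof (induction f rule: zpoly_induct)
  case zero
  have "p > 0" using assms by (rule prime_gt_0_nat)
  then show ?case by (simp add: zfrob_def power_0_left)
next
  case (mono m)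
  have "zfrob p (frag_of m) = frag_of m ^ p"
    by (simp only: zfrob_def zeval_frag_of meval_power meval_zvar)
  then show ?case by simp
next
  case (diff f g)
  have "of_nat p dvd (zfrob p f - f ^ p) - (zfrob p g - g ^ p) + (f ^ p - ((f - g) ^ p + g ^ p))"
    using dvd_add_power_prime[OF assms, of "f - g" g]
    by (intro dvd_add[OF dvd_diff[OF diff]]) (simp only: diff_add_cancel)
  then show ?case by (simp add: zfrob_def zeval_diff algebra_simps)
qed

lemma cong_power_step:
  fixes x y :: "'r::comm_ring_1"
  assumes "of_nat (p ^ Suc k) dvd x - y"
  shows "of_nat (p ^ Suc (Suc k)) dvd x ^ p - y ^ p"
proof -
  have pd: "of_nat p dvd x - y"
    using assms by (metis dvd_trans dvd_triv_left of_nat_mult power_Suc)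
  have "x ^ p - y ^ p = (x - y) * (\<Sum>i<p. y ^ (p - Suc i) * x ^ i)"
    by (rule power_diff_sumr2)
  moreover have "of_nat p dvd (\<Sum>i<p. y ^ (p - Suc i) * x ^ i)"
  proof -
    have "of_nat p dvd (\<Sum>i<p. y ^ (p - Suc i) * (x ^ i - y ^ i))"
      using pd by (intro dvd_sum dvd_mult) (metis dvd_trans dvd_triv_left power_diff_sumr2)
    also have "(\<Sum>i<p. y ^ (p - Suc i) * (x ^ i - y ^ i))
        = (\<Sum>i<p. y ^ (p - Suc i) * x ^ i) - (\<Sum>i<p. y ^ (p - 1))"
      by (simp only: right_diff_distrib sum_subtractf flip: power_add)
         (intro arg_cong2[where f = minus] refl sum.cong arg_cong[where f = "power y"], auto)
    finally have "of_nat p dvd (\<Sum>i<p. y ^ (p - Suc i) * x ^ i) - of_nat p * y ^ (p - 1)"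
      by simp
    from dvd_add[OF this dvd_triv_left[of _ "y ^ (p - 1)"]] show ?thesis
      by (simp only: diff_add_cancel)
  qed
  ultimately have "of_nat (p ^ Suc k) * of_nat p dvd x ^ p - y ^ p"
    using mult_dvd_mono[OF assms] by simp
  then show ?thesis by (simp add: algebra_simps)
qed

lemma cong_power_iter:
  fixes x y :: "'r::comm_ring_1"
  assumes "of_nat p dvd x - y"
  shows "of_nat (p ^ Suc n) dvd x ^ (p ^ n) - y ^ (p ^ n)"
proof (induction n)
  case (Suc n)
  from cong_power_step[OF Suc] show ?case
    by (simp add: mult.commute flip: power_mult)
qed (use assms in simp)

text \<open>
  Dwork's criterion, for the Frobenius lift \<open>zfrob\<close> that raises each variable to its \<open>p\<close>-th power:
  the sequences satisfying it are exactly the ghost components of sequences of integral polynomials.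
\<close>

definition dwork :: "nat \<Rightarrow> (nat \<Rightarrow> 'v zpoly) \<Rightarrow> bool" where
  "dwork p g \<longleftrightarrow> (\<forall>n. of_nat (p ^ Suc n) dvd zfrob p (g n) - g (Suc n))"

lemma zfrob_ghost:
  assumes "prime p"
  shows "of_nat (p ^ Suc n) dvd
    zfrob p (ghost p S n) - (\<Sum>i\<le>n. of_nat (p ^ i) * S i ^ (p ^ (Suc n - i)))"
proof -
  have "zfrob p (ghost p S n) - (\<Sum>i\<le>n. of_nat (p ^ i) * S i ^ (p ^ (Suc n - i)))
      = (\<Sum>i\<le>n. of_nat (p ^ i) * (zfrob p (S i) ^ (p ^ (n - i)) - (S i ^ p) ^ (p ^ (n - i))))"
    unfolding ghost_def zfrob_def zeval_sum sum_subtractf[symmetric]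
  proof (intro sum.cong refl)
    fix i assume "i \<in> {..n}"
    then have "p ^ (Suc n - i) = p * p ^ (n - i)" by (simp add: Suc_diff_le)
    then show "zeval (\<lambda>v. zvar v ^ p) (of_nat (p ^ i) * S i ^ p ^ (n - i)) -
         of_nat (p ^ i) * S i ^ p ^ (Suc n - i) =
         of_nat (p ^ i) *
         (zeval (\<lambda>v. zvar v ^ p) (S i) ^ p ^ (n - i) - (S i ^ p) ^ p ^ (n - i))"
      by (simp only: zeval_mult zeval_of_nat zeval_power power_mult right_diff_distrib)
  qed
  moreover have "of_nat (p ^ Suc n) dvd
      of_nat (p ^ i) * (zfrob p (S i) ^ (p ^ (n - i)) - (S i ^ p) ^ (p ^ (n - i)))"
    if "i \<in> {..n}" for i
  proof -
    have "of_nat (p ^ i) * of_nat (p ^ Suc (n - i)) dvd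
      of_nat (p ^ i) * (zfrob p (S i) ^ (p ^ (n - i)) - (S i ^ p) ^ (p ^ (n - i)))"
      by (intro mult_dvd_mono dvd_refl cong_power_iter zfrob_cong assms)
    moreover have "p ^ Suc n = p ^ i * p ^ Suc (n - i)"
      using that by (simp flip: power_add)
    ultimately show ?thesis by (metis of_nat_mult)
  qed
  ultimately show ?thesis by (metis (no_types, lifting) dvd_sum)
qed

lemma ghost_Suc: "ghost p S (Suc n) =
    (\<Sum>i\<le>n. of_nat (p ^ i) * S i ^ (p ^ (Suc n - i))) + of_nat (p ^ Suc n) * S (Suc n)"
  by (simp add: ghost_def)

lemma ghost_0: "ghost p S 0 = S 0"
  by (simp add: ghost_def)

lemma dwork_ghost:
  assumes "prime p"
  shows "dwork p (ghost p S)"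
  unfolding dwork_def ghost_Suc diff_diff_eq[symmetric]
  using dvd_diff[OF zfrob_ghost[OF assms] dvd_triv_left] by blast

lemma dwork_add: "dwork p f \<Longrightarrow> dwork p g \<Longrightarrow> dwork p (\<lambda>n. f n + g n)"
  unfolding dwork_def zfrob_def zeval_add by (metis add_diff_add dvd_add)

lemma dwork_neg: "dwork p f \<Longrightarrow> dwork p (\<lambda>n. - f n)"
  unfolding dwork_def zfrob_def zeval_uminus by (metis dvd_minus_iff minus_diff_minus)

lemma dwork_mult: "dwork p f \<Longrightarrow> dwork p g \<Longrightarrow> dwork p (\<lambda>n. f n * g n)"
  unfolding dwork_def zfrob_def zeval_mult
  by (metis (no_types, lifting) dvd_add dvd_mult dvd_mult2 mult_diff_mult)

definition zquot :: "nat \<Rightarrow> 'v zpoly \<Rightarrow> 'v zpoly" where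
  "zquot m f = (SOME s. f = of_nat m * s)"

fun unghost :: "nat \<Rightarrow> (nat \<Rightarrow> 'v zpoly) \<Rightarrow> nat \<Rightarrow> 'v zpoly" where
  "unghost p g n = zquot (p ^ n) (g n - (\<Sum>i<n. of_nat (p ^ i) * unghost p g i ^ (p ^ (n - i))))"

declare unghost.simps [simp del]

lemma zquot: "of_nat m dvd f \<Longrightarrow> of_nat m * zquot m f = f"
  unfolding zquot_def dvd_def by (metis (mono_tags, lifting) someI_ex)

lemma ghost_unghost:
  assumes "prime p" "dwork p g"
  shows "ghost p (unghost p g) n = g n"
proof (induction n)
  case 0
  show ?case using zquot[of 1 "g 0"] by (simp add: ghost_0 unghost.simps[of p g 0])
next
  case (Suc n)
  let ?s = "\<Sum>i\<le>n. of_nat (p ^ i) * unghost p g i ^ (p ^ (Suc n - i))"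
  have "of_nat (p ^ Suc n) dvd (zfrob p (g n) - ?s) - (zfrob p (g n) - g (Suc n))"
  proof (rule dvd_diff)
    show "of_nat (p ^ Suc n) dvd zfrob p (g n) - ?s"
      using zfrob_ghost[OF assms(1), of n "unghost p g"] unfolding Suc .
    show "of_nat (p ^ Suc n) dvd zfrob p (g n) - g (Suc n)"
      using assms(2) unfolding dwork_def by blast
  qed
  then have "of_nat (p ^ Suc n) dvd g (Suc n) - ?s" by simp
  from zquot[OF this] show ?case
    unfolding ghost_Suc unghost.simps[of p g "Suc n"] lessThan_Suc_atMost by simp
qed

lemma ghost_inject:
  fixes S T :: "nat \<Rightarrow> 'v zpoly"
  assumes "p > 0" "\<And>n. ghost p S n = ghost p T n"
  shows "S = T"
proof
  fix n
  show "S n = T n"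
  proof (induction n rule: less_induct)
    case (less n)
    show ?case
    proof (cases n)
      case 0
      then show ?thesis using assms(2)[of 0] by (simp add: ghost_0)
    next
      case (Suc m)
      have "(\<Sum>i\<le>m. of_nat (p ^ i) * S i ^ (p ^ (Suc m - i)))
          = (\<Sum>i\<le>m. of_nat (p ^ i) * T i ^ (p ^ (Suc m - i)))"
        using less Suc by (intro sum.cong) auto
      with assms(2)[of "Suc m"] have "of_nat (p ^ Suc m) * S (Suc m) = of_nat (p ^ Suc m) * T (Suc m)"
        unfolding ghost_Suc by simp
      then show ?thesis
        unfolding Suc by (rule zpoly_torsion_free) (use assms(1) in simp)
    qed
  qed
qed

lemma ghost_witt_polys:
  assumes "prime p" "dwork p g"
  shows "ghost p (witt_polys p g) n = g n"
proof -
  have "\<exists>!S. \<forall>n. ghost p S n = g n"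
    using ghost_unghost[OF assms] ghost_inject[of p] prime_gt_0_nat[OF assms(1)] by metis
  from theI'[OF this] show ?thesis unfolding witt_polys_def by blast
qed

section \<open>Ring laws for Witt vectors\<close>

lemma ghost_zeval: "ghost p (\<lambda>n. zeval e (S n)) n = zeval e (ghost p S n)"
  by (simp add: ghost_def zeval_sum zeval_mult zeval_of_nat zeval_power del: of_nat_power)

lemma ghost_witt_X:
  "zeval (witt_subst a b) (ghost p (witt_X 0) n) = ghost p a n"
  "zeval (witt_subst a b) (ghost p (witt_X 1) n) = ghost p b n"
  by (simp_all add: witt_subst_def flip: ghost_zeval)

lemma ghost_wadd: "prime p \<Longrightarrow> ghost p (wadd p a b) n = ghost p a n + ghost p b n"
  unfolding wadd_def[abs_def] ghost_zeval witt_add_poly_def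
  by (simp only: ghost_witt_polys dwork_add dwork_ghost zeval_add ghost_witt_X)

lemma ghost_wmult: "prime p \<Longrightarrow> ghost p (wmult p a b) n = ghost p a n * ghost p b n"
  unfolding wmult_def[abs_def] ghost_zeval witt_mult_poly_def
  by (simp only: ghost_witt_polys dwork_mult dwork_ghost zeval_mult ghost_witt_X)

lemma ghost_wneg: "prime p \<Longrightarrow> ghost p (wneg p a) n = - ghost p a n"
  unfolding wneg_def[abs_def] ghost_zeval witt_neg_poly_def
  by (simp only: ghost_witt_polys dwork_neg dwork_ghost zeval_uminus ghost_witt_X)

lemma ghost_wzero: "p > 0 \<Longrightarrow> ghost p (\<lambda>_. 0) n = 0"
  by (simp add: ghost_def power_0_left)

lemma ghost_wone: "p > 0 \<Longrightarrow> ghost p wone n = 1"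
proof -
  assume "p > 0"
  then have "ghost p wone n = (\<Sum>i\<le>n. if i = 0 then 1 else 0 :: 'a)"
    unfolding ghost_def by (intro sum.cong) (auto simp: wone_def power_0_left)
  then show ?thesis by simp
qed

lemma zeval_zeval: "zeval e (zeval e' f) = zeval (\<lambda>v. zeval e (e' v)) f"
proof (induction f rule: zpoly_induct)
  case (mono m)
  have "zeval e (\<Prod>v\<in>K. e' v ^ k v) = (\<Prod>v\<in>K. zeval e (e' v) ^ k v)" for K k
    by (induction K rule: infinite_finite_induct) (simp_all add: zeval_mult zeval_power)
  then show ?case unfolding zeval_frag_of by (simp add: meval_def)
qed (simp_all add: zeval_diff)

lemma zeval_witt_subst:
  "zeval e (zeval (witt_subst a b) f) = zeval (witt_subst (\<lambda>i. zeval e (a i)) (\<lambda>i. zeval e (b i))) f"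
  unfolding zeval_zeval by (rule arg_cong[where f = "\<lambda>g. zeval g f"]) (auto simp: witt_subst_def)

lemma zeval_wadd: "zeval e (wadd p a b n) = wadd p (\<lambda>i. zeval e (a i)) (\<lambda>i. zeval e (b i)) n"
  and zeval_wmult: "zeval e (wmult p a b n) = wmult p (\<lambda>i. zeval e (a i)) (\<lambda>i. zeval e (b i)) n"
  and zeval_wneg: "zeval e (wneg p a n) = wneg p (\<lambda>i. zeval e (a i)) n"
  and zeval_wone: "zeval e (wone n) = wone n"
  by (simp_all add: wadd_def wmult_def wneg_def wone_def zeval_witt_subst)

context
  fixes p :: nat and a b c :: "nat \<Rightarrow> 'r::comm_ring_1" and e :: "nat \<times> nat \<Rightarrow> 'r"
  assumes p: "prime p"
  defines "e \<equiv> \<lambda>(j, i). if j = 0 then a i else if j = 1 then b i else c i"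
begin

private lemma lift_eqI:
  assumes "\<And>n. ghost p S n = ghost p T n"
  shows "(\<lambda>n. zeval e (S n)) = (\<lambda>n. zeval e (T n))"
  using ghost_inject[of p S T] assms p by (simp add: prime_gt_0_nat)

private lemma lift_X: "zeval e (zvar (0, i)) = a i" "zeval e (zvar (1, i)) = b i"
    "zeval e (zvar (2, i)) = c i"
  by (simp_all add: e_def)

private lemmas ghosts = ghost_wadd[OF p] ghost_wmult[OF p] ghost_wneg[OF p]
  ghost_wzero[OF prime_gt_0_nat[OF p]] ghost_wone[OF prime_gt_0_nat[OF p]]

private lemmas lifts = zeval_wadd zeval_wmult zeval_wneg zeval_wone zeval_0 lift_X

lemma wadd_assoc: "wadd p (wadd p a b) c = wadd p a (wadd p b c)"
  using lift_eqI[of "wadd p (wadd p (witt_X 0) (witt_X 1)) (witt_X 2)"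
      "wadd p (witt_X 0) (wadd p (witt_X 1) (witt_X 2))"]
  unfolding ghosts lifts by (simp add: add.assoc)

lemma wadd_commute: "wadd p a b = wadd p b a"
  using lift_eqI[of "wadd p (witt_X 0) (witt_X 1)" "wadd p (witt_X 1) (witt_X 0)"]
  unfolding ghosts lifts by (simp add: add.commute)

lemma wadd_0: "wadd p (\<lambda>_. 0) a = a"
  using lift_eqI[of "wadd p (\<lambda>_. 0) (witt_X 0)" "witt_X 0"]
  unfolding ghosts lifts by simp

lemma wadd_neg: "wadd p (wneg p a) a = (\<lambda>_. 0)"
  using lift_eqI[of "wadd p (wneg p (witt_X 0)) (witt_X 0)" "\<lambda>_. 0"]
  unfolding ghosts lifts by simp

lemma wmult_assoc: "wmult p (wmult p a b) c = wmult p a (wmult p b c)"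
  using lift_eqI[of "wmult p (wmult p (witt_X 0) (witt_X 1)) (witt_X 2)"
      "wmult p (witt_X 0) (wmult p (witt_X 1) (witt_X 2))"]
  unfolding ghosts lifts by (simp add: mult.assoc)

lemma wmult_commute: "wmult p a b = wmult p b a"
  using lift_eqI[of "wmult p (witt_X 0) (witt_X 1)" "wmult p (witt_X 1) (witt_X 0)"]
  unfolding ghosts lifts by (simp add: mult.commute)

lemma wmult_1: "wmult p wone a = a"
  using lift_eqI[of "wmult p wone (witt_X 0)" "witt_X 0"]
  unfolding ghosts lifts by simp

lemma wmult_distrib: "wmult p (wadd p a b) c = wadd p (wmult p a c) (wmult p b c)"
  using lift_eqI[of "wmult p (wadd p (witt_X 0) (witt_X 1)) (witt_X 2)"
      "wadd p (wmult p (witt_X 0) (witt_X 2)) (wmult p (witt_X 1) (witt_X 2))"]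
  unfolding ghosts lifts by (simp add: distrib_right)

end

section \<open>The ring of Witt vectors\<close>

text \<open>
  The \<open>p\<close>-typical Witt vectors of a commutative ring of prime characteristic \<open>p\<close>, with
  \<open>p = CHAR('a)\<close> read off from the coefficient ring.
\<close>

typedef 'a witt = "UNIV :: (nat \<Rightarrow> 'a) set"
  morphisms witt_nth Abs_witt ..

lemmas witt_inverse = Abs_witt_inverse[OF UNIV_I]

instantiation witt :: (comm_ring_prime_char) comm_ring_1
begin

definition zero_witt :: "'a witt" where
  "zero_witt = Abs_witt (\<lambda>_. 0)"

definition one_witt :: "'a witt" where
  "one_witt = Abs_witt (\<lambda>n. if n = 0 then 1 else 0)"

definition plus_witt :: "'a witt \<Rightarrow> 'a witt \<Rightarrow> 'a witt" where
  "plus_witt a b = Abs_witt (wadd CHAR('a) (witt_nth a) (witt_nth b))"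

definition times_witt :: "'a witt \<Rightarrow> 'a witt \<Rightarrow> 'a witt" where
  "times_witt a b = Abs_witt (wmult CHAR('a) (witt_nth a) (witt_nth b))"

definition uminus_witt :: "'a witt \<Rightarrow> 'a witt" where
  "uminus_witt a = Abs_witt (wneg CHAR('a) (witt_nth a))"

definition minus_witt :: "'a witt \<Rightarrow> 'a witt \<Rightarrow> 'a witt" where
  "minus_witt a b = a + (- b)"

instance
proof
  fix a b c :: "'a witt"
  note defs = zero_witt_def one_witt_def[folded wone_def[abs_def]] plus_witt_def times_witt_def
    uminus_witt_def witt_inverse
  show "a + b + c = a + (b + c)" by (simp add: defs wadd_assoc)
  show "a + b = b + a" unfolding defs by (simp only: wadd_commute[OF CHAR_prime])
  show "0 + a = a" by (simp add: defs wadd_0 witt_nth_inverse)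
  show "- a + a = 0" by (simp add: defs wadd_neg)
  show "a - b = a + - b" by (rule minus_witt_def)
  show "a * b * c = a * (b * c)" by (simp add: defs wmult_assoc)
  show "a * b = b * a" unfolding defs by (simp only: wmult_commute[OF CHAR_prime])
  show "1 * a = a" by (simp add: defs wmult_1 witt_nth_inverse)
  show "(a + b) * c = a * c + b * c" by (simp add: defs wmult_distrib)
  show "(0::'a witt) \<noteq> 1"
  proof
    assume "(0::'a witt) = 1"
    then have "witt_nth (0::'a witt) 0 = witt_nth (1::'a witt) 0" by simp
    then show False by (simp add: zero_witt_def one_witt_def witt_inverse)
  qed
qed

end

section \<open>Ideals and quotients\<close>

text \<open>Ideals are submodules of the ring, viewed as a module over itself.\<close>

abbreviation is_ideal :: "'r::comm_ring_1 set \<Rightarrow> bool" where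
  "is_ideal \<equiv> module.subspace (*)"

abbreviation ideal_generated :: "'r::comm_ring_1 set \<Rightarrow> 'r set" where
  "ideal_generated \<equiv> module.span (*)"

definition cosets :: "'v::ab_group_add set \<Rightarrow> 'v set set" where
  "cosets U = UNIV // {(f, g). f - g \<in> U}"

text \<open>
  The dimension of the quotient of a vector space by a subspace \<open>U\<close>. The vectors in \<open>B\<close> represent
  a basis of the quotient: modulo \<open>U\<close>, every vector is a unique linear combination of them.
  The value of \<open>quotient_dim\<close> is meaningful only if the quotient is finite-dimensional.
\<close>

definition quotient_basis ::
    "('k::field \<Rightarrow> 'v::ab_group_add \<Rightarrow> 'v) \<Rightarrow> 'v set \<Rightarrow> 'v set \<Rightarrow> bool" where
  "quotient_basis scale U B \<longleftrightarrow> finite B \<and>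
     (\<forall>v. \<exists>!c. (\<forall>b. b \<notin> B \<longrightarrow> c b = 0) \<and> v - (\<Sum>b\<in>B. scale (c b) b) \<in> U)"

definition quotient_dim ::
    "('k::field \<Rightarrow> 'v::ab_group_add \<Rightarrow> 'v) \<Rightarrow> 'v set \<Rightarrow> nat" where
  "quotient_dim scale U = (THE n. \<exists>B. quotient_basis scale U B \<and> card B = n)"

section \<open>The two ideals attached to a Young diagram\<close>

text \<open>
  The ring of power series in \<open>x\<close> and \<open>y\<close> over \<open>'a\<close> is \<open>'a fps fps\<close>: power series in \<open>x\<close> whose
  coefficients are power series in \<open>y\<close>.
\<close>

definition X2 :: "'a::comm_ring_1 fps fps" where
  "X2 = fps_X"

definition Y2 :: "'a::comm_ring_1 fps fps" where
  "Y2 = fps_const fps_X"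

definition scale2 :: "'a::comm_ring_1 \<Rightarrow> 'a fps fps \<Rightarrow> 'a fps fps" where
  "scale2 c f = fps_const (fps_const c) * f"

definition I_lambda :: "nat \<Rightarrow> nat \<Rightarrow> nat \<Rightarrow> 'a::comm_ring_1 fps fps set" where
  "I_lambda A B C = ideal_generated {X2 ^ 3, X2 ^ 2 * Y2 ^ C, X2 * Y2 ^ B, Y2 ^ A}"

definition WI_lambda :: "nat \<Rightarrow> nat \<Rightarrow> nat \<Rightarrow> 'a::comm_ring_prime_char witt fps set" where
  "WI_lambda A B C = (let p = of_nat CHAR('a) in
     ideal_generated {fps_X ^ 3, p ^ C * fps_X ^ 2, p ^ B * fps_X, p ^ A})"

text \<open>
  The logarithm of the cardinality of a finite quotient. For the ideals considered here the
  quotient has \<open>q ^ n\<close> elements for a natural number \<open>n\<close>, so rounding does not change the value.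
\<close>

definition log_card_quotient :: "nat \<Rightarrow> 'v::ab_group_add set \<Rightarrow> nat" where
  "log_card_quotient q U = nat \<lfloor>log (real q) (real (card (cosets U)))\<rfloor>"

end

(*
  Let R be F_q[[y]] or W(F_q), with uniformizer pi = y or p. An ideal of R[[x]] containing x^3,
  pi^C x^2, pi^B x and pi^A has a unique Hermite normal form: modulo x^3 it is the R-span of
    pi^a + v x + w x^2,   pi^b x + u x^2,   pi^c x^2
  with u, w taken from fixed representatives of R / pi^c and v from those of R / pi^b, and the
  quotient by it has q^(a+b+c) elements. Closure under x and containment of the four generators
  become congruences on (u, v, w). Once the valuation k of u is fixed they are linear in v and then
  in w, and there are q^(c-k) - q^(c-k-1) (or 1, if k = c) choices of u. So the number of ideals for
  each (a, b, c) is an expression in q, A, B, C in which R does not occur.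

  All that is used of R is that pi is a non-zero-divisor and that R / pi is a field with q elements.
  For Witt vectors this follows from p (a_0, a_1, ...) = (0, a_0^p, a_1^p, ...).
*)
theory Submission
  imports Defs
begin

section \<open>Multiplication by the characteristic on Witt vectors\<close>

text \<open>Strong induction on n: if the entries below n agree modulo p, the terms below n of the
  two ghost components agree modulo p^(n+1). So p^(n+1) divides p^n (S n - T n), and p^n cancels
  because integral polynomials are torsion-free.\<close>

lemma ghost_cong:
  fixes S T :: "nat \<Rightarrow> 'v zpoly"
  assumes p: "p > 0" and cong: "\<And>n. of_nat (p ^ Suc n) dvd ghost p S n - ghost p T n"
  shows "of_nat p dvd S n - T n"
proof (induction n rule: less_induct)
  case (less n)
  let ?d = "\<lambda>i. of_nat (p ^ i) * (S i ^ (p ^ (n - i)) - T i ^ (p ^ (n - i)))"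
  have split: "ghost p S n - ghost p T n = (\<Sum>i<n. ?d i) + of_nat (p ^ n) * (S n - T n)"
    by (simp add: ghost_def sum_subtractf right_diff_distrib flip: lessThan_Suc_atMost)
  have "of_nat (p ^ Suc n) dvd ?d i" if "i < n" for i
  proof -
    have "of_nat (p ^ i) * of_nat (p ^ Suc (n - i)) dvd ?d i"
      by (intro mult_dvd_mono dvd_refl cong_power_iter less that)
    moreover have "p ^ Suc n = p ^ i * p ^ Suc (n - i)"
      using that by (simp flip: power_add)
    ultimately show ?thesis by (metis of_nat_mult)
  qed
  then have "of_nat (p ^ Suc n) dvd (\<Sum>i<n. ?d i)"
    by (intro dvd_sum) auto
  with cong[of n] have "of_nat (p ^ Suc n) dvd of_nat (p ^ n) * (S n - T n)"
    unfolding split using dvd_add_right_iff by blast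
  then obtain h where "of_nat (p ^ n) * (S n - T n) = of_nat (p ^ n) * (of_nat p * h)"
    by (auto simp: dvd_def mult_ac)
  from zpoly_torsion_free[OF this] p show ?case by simp
qed

text \<open>In characteristic p this is Verschiebung after Frobenius, which is how multiplication by
  p acts on Witt vectors.\<close>

definition wshift_frob :: "nat \<Rightarrow> (nat \<Rightarrow> 'r::comm_ring_1) \<Rightarrow> nat \<Rightarrow> 'r" where
  "wshift_frob p a n = (case n of 0 \<Rightarrow> 0 | Suc m \<Rightarrow> a m ^ p)"

text \<open>Iterating \<open>wadd\<close> instead of using the ring \<open>witt\<close> keeps the
  m-fold sum available over the integral polynomials, which have characteristic zero.\<close>

abbreviation wtimes_nat :: "nat \<Rightarrow> nat \<Rightarrow> (nat \<Rightarrow> 'r::comm_ring_1) \<Rightarrow> nat \<Rightarrow> 'r" where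
  "wtimes_nat p m a \<equiv> (wadd p a ^^ m) (\<lambda>_. 0)"

lemma ghost_wtimes_nat: "prime p \<Longrightarrow> ghost p (wtimes_nat p m a) n = of_nat m * ghost p a n"
  by (induction m) (simp_all add: ghost_wadd ghost_wzero prime_gt_0_nat distrib_right)

lemma zeval_wtimes_nat: "zeval e (wtimes_nat p m a n) = wtimes_nat p m (\<lambda>i. zeval e (a i)) n"
  by (induction m arbitrary: n) (simp_all add: zeval_wadd)

text \<open>Multiplication by p turns term i of the ghost component of \<open>a\<close> into term i
  + 1 of that of the shift; only the top term i = n is left over.\<close>

lemma ghost_wshift_frob:
  assumes "p > 0"
  shows "of_nat p * ghost p a n = ghost p (wshift_frob p a) n + of_nat (p ^ Suc n) * a n"
proof -
  have "ghost p (wshift_frob p a) n = (\<Sum>i<n. of_nat (p ^ Suc i) * a i ^ (p ^ (n - i)))"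
  proof (cases n)
    case 0
    then show ?thesis by (simp add: ghost_0 wshift_frob_def)
  next
    case (Suc m)
    have "p ^ (Suc m - i) = p * p ^ (m - i)" if "i < Suc m" for i
      using that by (simp add: Suc_diff_le less_Suc_eq_le)
    with assms show ?thesis
      by (simp add: Suc ghost_def sum.atMost_Suc_shift wshift_frob_def lessThan_Suc_atMost
          power_0_left power_mult less_Suc_eq_le
          del: sum.lessThan_Suc sum.atMost_Suc)
  qed
  then show ?thesis
    by (simp add: ghost_def sum_distrib_left distrib_left mult_ac flip: lessThan_Suc_atMost)
qed

text \<open>
  Over \<open>\<int>[X\<^sub>0, X\<^sub>1, \<dots>]\<close> the \<open>n\<close>-th ghost components of the two sides differ by \<open>p\<^bsup>n+1\<^esup> X\<^sub>n\<close>,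
  so the two sides agree modulo \<open>p\<close>.
\<close>

lemma wtimes_nat_char:
  fixes a :: "nat \<Rightarrow> 'r::comm_ring_1"
  assumes p: "prime p" and char: "of_nat p = (0::'r)"
  shows "wtimes_nat p p a = wshift_frob p a"
proof
  fix n
  let ?e = "\<lambda>(j::nat, i). a i"
  have "of_nat p dvd wtimes_nat p p (witt_X 0) n - wshift_frob p (witt_X 0) n"
    by (rule ghost_cong[OF prime_gt_0_nat[OF p]])
       (simp only: ghost_wtimes_nat[OF p] ghost_wshift_frob[OF prime_gt_0_nat[OF p]]
          add_diff_cancel_left' dvd_triv_left)
  then obtain h where "wtimes_nat p p (witt_X 0) n - wshift_frob p (witt_X 0) n = of_nat p * h"
    by (elim dvdE)
  from arg_cong[OF this, of "zeval ?e"] show "wtimes_nat p p a n = wshift_frob p a n"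
    by (simp add: zeval_diff zeval_wtimes_nat zeval_mult zeval_of_nat char)
       (simp add: wshift_frob_def zeval_power split: nat.splits)
qed

section \<open>Coordinates of Witt vectors and divisibility by p\<close>

lemma witt_nth_0 [simp]: "witt_nth (0::'a::comm_ring_prime_char witt) n = 0"
  by (simp add: zero_witt_def witt_inverse)

lemma witt_nth_1: "witt_nth (1::'a::comm_ring_prime_char witt) n = (if n = 0 then 1 else 0)"
  by (simp add: one_witt_def witt_inverse)

lemma witt_eq_iff: "a = b \<longleftrightarrow> (\<forall>n. witt_nth a n = witt_nth b n)"
  by (metis ext witt_nth_inject)

lemma witt_nth_of_nat_mult:
  fixes a :: "'a::comm_ring_prime_char witt"
  shows "witt_nth (of_nat m * a) = wtimes_nat CHAR('a) m (witt_nth a)"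
proof (induction m)
  case (Suc m)
  have "of_nat (Suc m) * a = a + of_nat m * a" by (simp add: distrib_right)
  with Suc show ?case by (simp only: plus_witt_def witt_inverse funpow.simps o_def)
qed (simp add: fun_eq_iff)

lemma witt_nth_char_mult:
  fixes a :: "'a::comm_ring_prime_char witt"
  shows "witt_nth (of_nat CHAR('a) * a) n = (case n of 0 \<Rightarrow> 0 | Suc m \<Rightarrow> witt_nth a m ^ CHAR('a))"
  unfolding witt_nth_of_nat_mult wtimes_nat_char[OF CHAR_prime of_nat_CHAR] wshift_frob_def ..

text \<open>Coordinate 0 is the ghost component 0, so this and the next lemma make it a ring
  homomorphism to the coefficients.\<close>

lemma witt_nth_0_add:
  fixes a b :: "'a::comm_ring_prime_char witt"
  shows "witt_nth (a + b) 0 = witt_nth a 0 + witt_nth b 0"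
  using ghost_wadd[OF CHAR_prime, of "witt_nth a" "witt_nth b" 0]
  by (simp add: ghost_0 plus_witt_def witt_inverse)

lemma witt_nth_0_mult:
  fixes a b :: "'a::comm_ring_prime_char witt"
  shows "witt_nth (a * b) 0 = witt_nth a 0 * witt_nth b 0"
  using ghost_wmult[OF CHAR_prime, of "witt_nth a" "witt_nth b" 0]
  by (simp add: ghost_0 times_witt_def witt_inverse)

lemma witt_nth_0_diff:
  fixes a b :: "'a::comm_ring_prime_char witt"
  shows "witt_nth (a - b) 0 = witt_nth a 0 - witt_nth b 0"
  using witt_nth_0_add[of "a - b" b] by simp

text \<open>In characteristic p, (x - y)^p = x^p - y^p, so the p-th power map is injective on a
  field and hence surjective on a finite one.\<close>

lemma surj_power_CHAR: "surj (\<lambda>x::'a::finite_field. x ^ CHAR('a))"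
proof (rule finite_UNIV_inj_surj)
  have "x = y" if "x ^ CHAR('a) = y ^ CHAR('a)" for x y :: 'a
  proof -
    have "of_nat CHAR('a) dvd ((x - y) + y) ^ CHAR('a) - ((x - y) ^ CHAR('a) + y ^ CHAR('a))"
      by (rule dvd_add_power_prime) simp
    with that show ?thesis by simp
  qed
  then show "inj (\<lambda>x::'a. x ^ CHAR('a))" by (auto intro: injI)
qed simp

text \<open>Multiples of p have coordinates (0, b_0^p, b_1^p, ...), and every element of a finite
  field is a p-th power. Thus the Witt vectors modulo p are the coefficient field.\<close>

lemma witt_char_dvd_iff:
  fixes a :: "'a::finite_field witt"
  shows "of_nat CHAR('a) dvd a \<longleftrightarrow> witt_nth a 0 = 0"
proof
  assume "of_nat CHAR('a) dvd a"
  then show "witt_nth a 0 = 0"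
    by (auto simp: dvd_def witt_nth_char_mult simp del: of_nat_CHAR)
next
  assume a: "witt_nth a 0 = 0"
  define b :: "'a witt" where "b = Abs_witt (\<lambda>n. inv (\<lambda>x. x ^ CHAR('a)) (witt_nth a (Suc n)))"
  have "witt_nth b n ^ CHAR('a) = witt_nth a (Suc n)" for n
    using surj_f_inv_f[OF surj_power_CHAR] by (simp add: b_def witt_inverse)
  with a have "a = of_nat CHAR('a) * b"
    unfolding witt_eq_iff witt_nth_char_mult by (simp split: nat.splits)
  then show "of_nat CHAR('a) dvd a" by (rule dvdI)
qed

lemma witt_char_mult_eq_0_iff:
  fixes a :: "'a::finite_field witt"
  shows "of_nat CHAR('a) * a = 0 \<longleftrightarrow> a = 0"
proof
  assume "of_nat CHAR('a) * a = 0"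
  then have "witt_nth (of_nat CHAR('a) * a) (Suc n) = 0" for n by (simp only: witt_nth_0)
  then have "witt_nth a n = 0" for n by (simp add: witt_nth_char_mult)
  then show "a = 0" by (simp add: witt_eq_iff)
qed simp

section \<open>Residues modulo powers of a uniformizer\<close>

text \<open>The axioms make \<pi> a non-zero-divisor whose residue ring is a field with
  \<open>D\<close> as a finite set of representatives, so \<open>card D\<close> is q. Keeping
  \<open>D\<close> a parameter lets constants serve for power series and Teichmueller
  representatives for Witt vectors.\<close>

locale uniformizer =
  fixes \<pi> :: "'r::comm_ring_1" and D :: "'r set"
  assumes cancel: "\<pi> * x = 0 \<Longrightarrow> x = 0"
    and inverse_mod: "\<not> \<pi> dvd x \<Longrightarrow> \<exists>y. \<pi> dvd x * y - 1"
    and not_unit: "\<not> \<pi> dvd 1"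
    and finite_digits: "finite D"
    and digit_ex: "\<exists>d\<in>D. \<pi> dvd x - d"
    and digit_eq: "d \<in> D \<Longrightarrow> d' \<in> D \<Longrightarrow> \<pi> dvd d - d' \<Longrightarrow> d = d'"
begin

section \<open>Divisibility by powers of the uniformizer\<close>

lemma power_cancel: "\<pi> ^ n * x = \<pi> ^ n * y \<longleftrightarrow> x = y"
proof -
  have "\<pi> ^ n * z = 0 \<Longrightarrow> z = 0" for z
  proof (induction n)
    case (Suc n)
    then show ?case using cancel[of "\<pi> ^ n * z"] by (simp only: power_Suc mult.assoc)
  qed simp
  from this[of "x - y"] show ?thesis by (auto simp: right_diff_distrib)
qed

lemma power_mult_eq_0 [simp]: "\<pi> ^ n * x = 0 \<longleftrightarrow> x = 0"
  using power_cancel[of n x 0] by simp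

lemma power_dvd_power_mult: "\<pi> ^ n dvd \<pi> ^ j * x \<longleftrightarrow> \<pi> ^ (n - j) dvd x"
proof (cases "j \<le> n")
  case True
  then have "\<pi> ^ n = \<pi> ^ j * \<pi> ^ (n - j)" by (simp flip: power_add)
  then show ?thesis by (simp add: dvd_def mult.assoc power_cancel)
next
  case False
  then show ?thesis by (simp add: le_imp_power_dvd dvd_mult2)
qed

lemma power_dvd_1_iff [simp]: "\<pi> ^ n dvd 1 \<longleftrightarrow> n = 0"
  by (cases n) (use not_unit dvd_mult_left in auto)

lemma power_dvd_power_iff [simp]: "\<pi> ^ m dvd \<pi> ^ n \<longleftrightarrow> m \<le> n"
  using power_dvd_power_mult[of m n 1] by simp

lemma power_dvd_max: "\<pi> ^ max m n dvd x \<longleftrightarrow> \<pi> ^ m dvd x \<and> \<pi> ^ n dvd x"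
  by (auto simp: max_def intro: dvd_trans[OF le_imp_power_dvd])

text \<open>If y inverts x modulo \<pi>, then (1 - x y)^n is divisible by \<pi>^n and has the form 1
  + x z, so -z inverts x modulo \<pi>^n.\<close>

lemma inverse_mod_power:
  assumes "\<not> \<pi> dvd x"
  shows "\<exists>y. \<pi> ^ n dvd x * y - 1"
proof -
  obtain y where y: "\<pi> dvd x * y - 1" using inverse_mod[OF assms] by blast
  have "x dvd (1 - x * y) ^ n - 1 ^ n"
    unfolding power_diff_sumr2 by simp
  then obtain z where "(1 - x * y) ^ n - 1 = x * z" by (auto elim: dvdE)
  then have "x * (- z) - 1 = - ((1 - x * y) ^ n)" by (simp add: algebra_simps)
  moreover from y have "\<pi> ^ n dvd (1 - x * y) ^ n"
    by (metis dvd_power_same dvd_minus_iff minus_diff_eq)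
  ultimately show ?thesis by (metis dvd_minus_iff)
qed

lemma power_dvd_unit_mult:
  assumes "\<not> \<pi> dvd u"
  shows "\<pi> ^ n dvd u * x \<longleftrightarrow> \<pi> ^ n dvd x"
proof
  assume *: "\<pi> ^ n dvd u * x"
  obtain y where y: "\<pi> ^ n dvd u * y - 1" using inverse_mod_power[OF assms] by blast
  have "x = y * (u * x) - (u * y - 1) * x" by (simp add: algebra_simps)
  moreover have "\<pi> ^ n dvd y * (u * x) - (u * y - 1) * x"
    by (rule dvd_diff[OF dvd_mult[OF *] dvd_mult2[OF y]])
  ultimately show "\<pi> ^ n dvd x" by metis
qed simp

section \<open>Representatives modulo \<pi>^n: expansions of length n with digits in
  \<open>D\<close>\<close>

primrec residues :: "nat \<Rightarrow> 'r set" where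
  "residues 0 = {0}"
| "residues (Suc n) = (\<lambda>(d, t). d + \<pi> * t) ` (D \<times> residues n)"

lemma residue_ex: "\<exists>t\<in>residues n. \<pi> ^ n dvd x - t"
proof (induction n arbitrary: x)
  case (Suc n)
  obtain d x' where d: "d \<in> D" "x - d = \<pi> * x'" using digit_ex[of x] by (auto elim: dvdE)
  obtain t where t: "t \<in> residues n" "\<pi> ^ n dvd x' - t" using Suc by blast
  have "x - (d + \<pi> * t) = \<pi> * (x' - t)" using d(2) by (simp add: algebra_simps)
  with t(2) have "\<pi> ^ Suc n dvd x - (d + \<pi> * t)" by (simp add: mult_dvd_mono)
  with d(1) t(1) show ?case by force
qed simp

lemma residue_eq_aux:
  assumes "d \<in> D" "d' \<in> D" "\<pi> ^ Suc n dvd (d + \<pi> * t) - (d' + \<pi> * t')"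
  shows "d = d'" "\<pi> ^ n dvd t - t'"
proof -
  have eq: "(d + \<pi> * t) - (d' + \<pi> * t') = (d - d') + \<pi> * (t - t')" by (simp add: algebra_simps)
  with assms(3) have "\<pi> dvd (d - d') + \<pi> * (t - t')" by (metis dvd_mult_left power_Suc)
  then have "\<pi> dvd d - d'" by (simp add: dvd_add_left_iff)
  then show d: "d = d'" by (rule digit_eq[OF assms(1,2)])
  from assms(3) have "\<pi> ^ Suc n dvd \<pi> ^ 1 * (t - t')" by (simp add: d algebra_simps)
  then show "\<pi> ^ n dvd t - t'" by (simp only: power_dvd_power_mult) simp
qed

lemma residue_eq: "t \<in> residues n \<Longrightarrow> t' \<in> residues n \<Longrightarrow> \<pi> ^ n dvd t - t' \<Longrightarrow> t = t'"
proof (induction n arbitrary: t t')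
  case (Suc n)
  from Suc.prems obtain d s d' s' where
    t: "t = d + \<pi> * s" "t' = d' + \<pi> * s'" "d \<in> D" "d' \<in> D" "s \<in> residues n" "s' \<in> residues n"
    by auto
  with Suc.prems have "d = d'" "\<pi> ^ n dvd s - s'"
    using residue_eq_aux by metis+
  with Suc.IH[OF t(5,6)] t(1,2) show ?case by simp
qed simp

lemma finite_residues [simp]: "finite (residues n)"
  by (induction n) (use finite_digits in auto)

lemma card_residues: "card (residues n) = card D ^ n"
proof (induction n)
  case (Suc n)
  have "inj_on (\<lambda>(d, t). d + \<pi> * t) (D \<times> residues n)"
  proof (rule inj_onI, clarify)
    fix d t d' t' assume *: "d \<in> D" "d' \<in> D" "t \<in> residues n" "t' \<in> residues n"
      and "d + \<pi> * t = d' + \<pi> * t'"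
    then have "\<pi> ^ Suc n dvd (d + \<pi> * t) - (d' + \<pi> * t')" by simp
    from residue_eq_aux[OF *(1,2) this] residue_eq[OF *(3,4)] show "d = d' \<and> t = t'" by blast
  qed
  with Suc show ?case by (simp add: card_image card_cartesian_product)
qed simp

text \<open>0 and 1 have different digits, as \<pi> does not divide 1. The bound makes logarithms to
  base q meaningful.\<close>

lemma card_digits_gt_1: "card D > 1"
proof -
  obtain d e where de: "d \<in> D" "\<pi> dvd 0 - d" "e \<in> D" "\<pi> dvd 1 - e"
    using digit_ex[of 0] digit_ex[of 1] by blast
  have "d \<noteq> e"
  proof
    assume "d = e"
    with de(2) have "\<pi> dvd (1 - e) + e" by (intro dvd_add de(4)) simp
    then show False using not_unit by simp
  qed
  with de finite_digits have "card {d, e} \<le> card D" by (intro card_mono) auto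
  with \<open>d \<noteq> e\<close> show ?thesis by simp
qed

text \<open>The solutions are the reductions of x + \<pi>^m z modulo \<pi>^n, with z taken modulo
  \<pi>^(n - m).\<close>

lemma card_residues_cong:
  assumes "m \<le> n"
  shows "card {w \<in> residues n. \<pi> ^ m dvd w - x} = card D ^ (n - m)"
proof -
  obtain \<rho> where \<rho>: "\<And>z. \<rho> z \<in> residues n" "\<And>z. \<pi> ^ n dvd z - \<rho> z"
    using residue_ex[of n] by metis
  have mn: "\<pi> ^ m dvd z" if "\<pi> ^ n dvd z" for z
    using that assms by (meson dvd_trans le_imp_power_dvd)
  have "bij_betw (\<lambda>z. \<rho> (x + \<pi> ^ m * z)) (residues (n - m)) {w \<in> residues n. \<pi> ^ m dvd w - x}"
  proof (rule bij_betwI')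
    fix z z' assume z: "z \<in> residues (n - m)" "z' \<in> residues (n - m)"
    have "z = z'" if "\<rho> (x + \<pi> ^ m * z) = \<rho> (x + \<pi> ^ m * z')"
    proof (rule residue_eq[OF z])
      have "\<pi> ^ n dvd (x + \<pi> ^ m * z - \<rho> (x + \<pi> ^ m * z)) - (x + \<pi> ^ m * z' - \<rho> (x + \<pi> ^ m * z'))"
        by (intro dvd_diff \<rho>)
      with that show "\<pi> ^ (n - m) dvd z - z'"
        by (simp add: power_dvd_power_mult flip: right_diff_distrib)
    qed
    then show "\<rho> (x + \<pi> ^ m * z) = \<rho> (x + \<pi> ^ m * z') \<longleftrightarrow> z = z'" by blast
  next
    fix z
    have "\<pi> ^ m dvd \<pi> ^ m * z - (x + \<pi> ^ m * z - \<rho> (x + \<pi> ^ m * z))"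
      by (rule dvd_diff[OF dvd_triv_left mn[OF \<rho>(2)]])
    then show "\<rho> (x + \<pi> ^ m * z) \<in> {w \<in> residues n. \<pi> ^ m dvd w - x}"
      using \<rho>(1) by simp
  next
    fix w assume w: "w \<in> {w \<in> residues n. \<pi> ^ m dvd w - x}"
    then obtain z0 where z0: "w - x = \<pi> ^ m * z0" by (auto elim: dvdE)
    obtain z where z: "z \<in> residues (n - m)" "\<pi> ^ (n - m) dvd z0 - z" using residue_ex by blast
    have "\<pi> ^ n dvd \<pi> ^ m * (z0 - z) + (x + \<pi> ^ m * z - \<rho> (x + \<pi> ^ m * z))"
      using z(2) by (intro dvd_add \<rho>) (simp add: power_dvd_power_mult)
    moreover have "\<pi> ^ m * (z0 - z) = w - x - \<pi> ^ m * z"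
      using z0 by (simp add: right_diff_distrib)
    ultimately have "\<pi> ^ n dvd w - \<rho> (x + \<pi> ^ m * z)" by simp
    then have "w = \<rho> (x + \<pi> ^ m * z)" using w \<rho>(1) by (intro residue_eq) auto
    with z(1) show "\<exists>z\<in>residues (n - m). w = \<rho> (x + \<pi> ^ m * z)" by blast
  qed
  then show ?thesis by (simp add: card_residues flip: bij_betw_same_card)
qed

lemma card_residues_dvd: "m \<le> n \<Longrightarrow> card {w \<in> residues n. \<pi> ^ m dvd w} = card D ^ (n - m)"
  using card_residues_cong[of m n 0] by simp

end

section \<open>Counting the solutions of the Hermite normal form conditions\<close>

text \<open>
  Here \<open>d = A - a\<close>, \<open>h = a - b\<close>, \<open>j = B - b\<close>, and \<open>k\<close> is the valuation of \<open>u\<close>, capped at \<open>c\<close>. The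
  congruence for \<open>w\<close> has \<open>q ^ m\<close> solutions or none, and it is solvable exactly when \<open>\<pi> ^ e\<close> divides \<open>v\<close>.
\<close>

definition hermite_pair_count :: "nat \<Rightarrow> nat \<Rightarrow> nat \<Rightarrow> nat \<Rightarrow> nat \<Rightarrow> nat \<Rightarrow> nat \<Rightarrow> nat" where
  "hermite_pair_count q j b c d h k =
    (let m = min d c; e = max (b - d) (b + m - d - k)
     in if c \<le> j + k \<and> min c e \<le> h + k then q ^ (b - max c e) * q ^ m else 0)"

text \<open>The first factor is the number of residues u of capped valuation k; the value k = c is
  taken by one residue only, the class of 0.\<close>

definition hermite_count :: "nat \<Rightarrow> nat \<Rightarrow> nat \<Rightarrow> nat \<Rightarrow> nat \<Rightarrow> nat \<Rightarrow> nat" where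
  "hermite_count q A B a b c =
    (\<Sum>k\<le>c. (if k = c then 1 else q ^ (c - k) - q ^ (c - Suc k)) *
      hermite_pair_count q (B - b) b c (A - a) (a - b) k)"

section \<open>Admissible triples (u, v, w) for fixed exponents (a, b, c)\<close>

context uniformizer
begin

text \<open>The conditions express, in order: x times the first row stays in the span; \<pi>^B x
  lies in it; \<pi>^A lies in it. In the last one, s is the multiple of the second row to subtract
  from \<pi>^(A - a) times the first.\<close>

definition admissible :: "nat \<Rightarrow> nat \<Rightarrow> nat \<Rightarrow> nat \<Rightarrow> nat \<Rightarrow> 'r \<Rightarrow> 'r \<Rightarrow> 'r \<Rightarrow> bool" where
  "admissible A B a b c u v w \<longleftrightarrow> \<pi> ^ c dvd v - \<pi> ^ (a - b) * u \<and> \<pi> ^ c dvd \<pi> ^ (B - b) * u \<and>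
    (\<exists>s. \<pi> ^ (A - a) * v = \<pi> ^ b * s \<and> \<pi> ^ c dvd \<pi> ^ (A - a) * w - s * u)"

text \<open>Only u modulo \<pi>^c matters, so the valuation is cut off at c; multiples of \<pi>^c,
  among them 0, get the value c.\<close>

definition valuation_upto :: "nat \<Rightarrow> 'r \<Rightarrow> nat \<Rightarrow> bool" where
  "valuation_upto c u k \<longleftrightarrow> k \<le> c \<and> \<pi> ^ k dvd u \<and> (k < c \<longrightarrow> \<not> \<pi> ^ Suc k dvd u)"

lemma valuation_upto_unit:
  assumes "valuation_upto c u k" "k < c"
  obtains u' where "u = \<pi> ^ k * u'" "\<not> \<pi> dvd u'"
proof -
  from assms obtain u' where u': "u = \<pi> ^ k * u'" by (auto simp: valuation_upto_def)
  with assms have "\<not> \<pi> dvd u'"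
    using power_dvd_power_mult[of "Suc k" k u'] by (auto simp: valuation_upto_def)
  with u' that show ?thesis by blast
qed

text \<open>Below the cap, u is \<pi>^k times a factor invertible modulo every power of \<pi>; at
  the cap, \<pi>^n divides u already because n \<le> c.\<close>

lemma power_dvd_mult_valuation:
  assumes "valuation_upto c u k" "n \<le> c"
  shows "\<pi> ^ n dvd \<pi> ^ j * u \<longleftrightarrow> n \<le> j + k"
proof (cases "k < c")
  case True
  from valuation_upto_unit[OF assms(1) this] obtain u'
    where u': "u = \<pi> ^ k * u'" "\<not> \<pi> dvd u'" .
  show ?thesis
    using power_dvd_unit_mult[OF u'(2), of "n - j - k" 1]
    by (auto simp: u'(1) power_dvd_power_mult)
next
  case False
  with assms have "\<pi> ^ n dvd u" "k = c"
    by (auto simp: valuation_upto_def intro: dvd_trans[OF le_imp_power_dvd])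
  with assms(2) show ?thesis by (simp add: dvd_mult)
qed

lemma valuation_upto_ex1: "\<exists>!k. valuation_upto c u k"
proof (rule ex_ex1I)
  let ?k = "GREATEST k. k \<le> c \<and> \<pi> ^ k dvd u"
  have "?k \<le> c \<and> \<pi> ^ ?k dvd u"
    by (rule GreatestI_nat[of _ 0 c]) auto
  moreover have "\<not> \<pi> ^ Suc ?k dvd u" if "?k < c"
    using Greatest_le_nat[of "\<lambda>k. k \<le> c \<and> \<pi> ^ k dvd u" "Suc ?k" c] that by auto
  ultimately show "\<exists>k. valuation_upto c u k" unfolding valuation_upto_def by blast
next
  fix k l assume kl: "valuation_upto c u k" "valuation_upto c u l"
  show "k = l"
    using kl power_dvd_mult_valuation[OF kl(1), of l 0] power_dvd_mult_valuation[OF kl(2), of k 0]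
    by (auto simp: valuation_upto_def)
qed

lemma card_valuation_upto:
  assumes "k \<le> c"
  shows "card {u \<in> residues c. valuation_upto c u k} =
    (if k = c then 1 else card D ^ (c - k) - card D ^ (c - Suc k))"
proof (cases "k = c")
  case True
  then show ?thesis using card_residues_cong[of c c 0] by (simp add: valuation_upto_def)
next
  case False
  let ?S = "\<lambda>k. {u \<in> residues c. \<pi> ^ k dvd u}"
  have "{u \<in> residues c. valuation_upto c u k} = ?S k - ?S (Suc k)"
    using False assms by (auto simp: valuation_upto_def)
  moreover have "?S (Suc k) \<subseteq> ?S k" by (auto dest: dvd_mult_right simp: mult.commute)
  ultimately show ?thesis
    using False assms by (simp add: card_Diff_subset card_residues_dvd del: power_Suc)
qed

text \<open>The congruence is linear in w: it is solvable iff \<pi>^(min d c) divides s u, and then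
  w is fixed modulo \<pi>^(c - d). Multiplying the criterion by \<pi>^b replaces s by v.\<close>

lemma card_admissible_snd:
  assumes "\<pi> ^ d * v = \<pi> ^ b * s"
  shows "card {w \<in> residues c. \<pi> ^ c dvd \<pi> ^ d * w - s * u} =
    (if \<pi> ^ (b + min d c) dvd \<pi> ^ d * (u * v) then card D ^ min d c else 0)"
proof -
  have "\<pi> ^ d * (u * v) = \<pi> ^ b * (s * u)"
    using assms by (metis mult.assoc mult.commute)
  then have iff: "\<pi> ^ (b + min d c) dvd \<pi> ^ d * (u * v) \<longleftrightarrow> \<pi> ^ min d c dvd s * u"
    by (simp add: power_dvd_power_mult)
  show ?thesis
  proof (cases "c \<le> d")
    case True
    then have "\<pi> ^ c dvd \<pi> ^ d * w" for w by (simp add: le_imp_power_dvd dvd_mult2)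
    then have "\<pi> ^ c dvd \<pi> ^ d * w - s * u \<longleftrightarrow> \<pi> ^ c dvd s * u" for w
      by (rule dvd_diff_right_iff)
    with True iff show ?thesis by (simp add: card_residues min_def)
  next
    case False
    have dvd: "\<pi> ^ d dvd s * u" if "\<pi> ^ c dvd \<pi> ^ d * w - s * u" for w
    proof -
      have "\<pi> ^ d dvd \<pi> ^ d * w - s * u"
        using False by (intro dvd_trans[OF le_imp_power_dvd that]) simp
      then show ?thesis by (simp add: dvd_diff_right_iff)
    qed
    show ?thesis
    proof (cases "\<pi> ^ d dvd s * u")
      case True
      then obtain y where y: "s * u = \<pi> ^ d * y" ..
      have "\<pi> ^ c dvd \<pi> ^ d * w - s * u \<longleftrightarrow> \<pi> ^ (c - d) dvd w - y" for w
        by (simp add: y power_dvd_power_mult flip: right_diff_distrib)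
      with False True iff show ?thesis
        by (simp add: card_residues_cong min_def)
    next
      case no: False
      then have "{w \<in> residues c. \<pi> ^ c dvd \<pi> ^ d * w - s * u} = {}" using dvd by blast
      with no iff False show ?thesis by (simp add: min_def)
    qed
  qed
qed

text \<open>The two conditions on v are compatible iff \<pi>^(min c e) divides \<pi>^h u; the one
  with the larger exponent then implies the other, leaving one congruence modulo \<pi>^(max c
  e).\<close>

lemma card_residues_cong_dvd:
  assumes "valuation_upto c u k" "c \<le> b" "e \<le> b"
  shows "card {v \<in> residues b. \<pi> ^ c dvd v - \<pi> ^ h * u \<and> \<pi> ^ e dvd v} =
    (if min c e \<le> h + k then card D ^ (b - max c e) else 0)"
proof (cases "c \<le> e")
  case True
  have "\<pi> ^ c dvd v" if "\<pi> ^ e dvd v" for v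
    using that True by (meson dvd_trans le_imp_power_dvd)
  then have "\<pi> ^ c dvd v - \<pi> ^ h * u \<and> \<pi> ^ e dvd v \<longleftrightarrow> c \<le> h + k \<and> \<pi> ^ e dvd v" for v
    using power_dvd_mult_valuation[OF assms(1), of c h] dvd_diff_right_iff by auto
  with True assms(3) show ?thesis
    by (simp add: card_residues_dvd min_def max_def)
next
  case False
  have "\<pi> ^ e dvd v - \<pi> ^ h * u" if "\<pi> ^ c dvd v - \<pi> ^ h * u" for v
    using that False by (meson dvd_trans le_imp_power_dvd nat_le_linear)
  then have "\<pi> ^ c dvd v - \<pi> ^ h * u \<and> \<pi> ^ e dvd v \<longleftrightarrow>
      e \<le> h + k \<and> \<pi> ^ c dvd v - \<pi> ^ h * u" for v
    using power_dvd_mult_valuation[OF assms(1), of e h] False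
    by (metis dvd_add_right_iff diff_add_cancel nat_le_linear)
  with False assms(2) show ?thesis
    by (simp add: card_residues_cong min_def max_def)
qed

text \<open>For fixed u the number of w is the same for every v that admits one, so the count is the
  number of such v times q^m.\<close>

lemma card_admissible_pairs:
  assumes u: "valuation_upto c u k" and "c \<le> b"
  shows "card {(v, w). v \<in> residues b \<and> w \<in> residues c \<and> admissible A B a b c u v w} =
    hermite_pair_count (card D) (B - b) b c (A - a) (a - b) k"
proof -
  define d m e where "d = A - a" and "m = min d c" and "e = max (b - d) (b + m - d - k)"
  define V where "V = {v \<in> residues b. \<pi> ^ c dvd v - \<pi> ^ (a - b) * u \<and> \<pi> ^ e dvd v}"
  define W where "W v = {w \<in> residues c. admissible A B a b c u v w}" for v
  \<comment> \<open>The solvability criterion for w becomes a condition on v alone; u enters only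
    through k.\<close>
  have "\<pi> ^ (b + m) dvd \<pi> ^ d * (u * v) \<longleftrightarrow> \<pi> ^ (b + m - d - k) dvd v"
    if v: "\<pi> ^ (b - d) dvd v" for v
  proof (cases "k < c")
    case True
    from valuation_upto_unit[OF u this] obtain u'
      where u': "u = \<pi> ^ k * u'" "\<not> \<pi> dvd u'" .
    then show ?thesis
      by (simp add: mult.assoc power_dvd_power_mult power_dvd_unit_mult)
  next
    case False
    with u have k: "k = c" "\<pi> ^ c dvd u" by (auto simp: valuation_upto_def)
    \<comment> \<open>At the cap both sides hold: m \<le> c, so \<pi>^c dividing u and \<pi>^(b - d)
      dividing v suffice.\<close>
    have "\<pi> ^ (b + m - d) dvd \<pi> ^ (c + (b - d))" by (auto simp: m_def)
    also have "\<dots> dvd u * v" unfolding power_add using k v by (intro mult_dvd_mono)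
    finally have "\<pi> ^ (b + m) dvd \<pi> ^ d * (u * v)" by (simp add: power_dvd_power_mult)
    moreover have "\<pi> ^ (b + m - d - k) dvd v"
      by (rule dvd_trans[OF le_imp_power_dvd v]) (auto simp: k m_def)
    ultimately show ?thesis by blast
  qed
  then have e_iff: "\<pi> ^ e dvd v \<longleftrightarrow> \<pi> ^ (b - d) dvd v \<and> \<pi> ^ (b + m) dvd \<pi> ^ d * (u * v)" for v
    unfolding e_def power_dvd_max by blast
  have card_W: "card (W v) =
      (if \<pi> ^ c dvd \<pi> ^ (B - b) * u \<and> \<pi> ^ c dvd v - \<pi> ^ (a - b) * u \<and> \<pi> ^ e dvd v
       then card D ^ m else 0)" for v
  proof (cases "\<pi> ^ (b - d) dvd v")
    case True
    then have "\<pi> ^ b dvd \<pi> ^ d * v" by (simp add: power_dvd_power_mult)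
    then obtain s where s: "\<pi> ^ d * v = \<pi> ^ b * s" ..
    show ?thesis
    proof (cases "\<pi> ^ c dvd \<pi> ^ (B - b) * u \<and> \<pi> ^ c dvd v - \<pi> ^ (a - b) * u")
      case yes: True
      then have "W v = {w \<in> residues c. \<pi> ^ c dvd \<pi> ^ d * w - s * u}"
        using s by (auto simp: W_def admissible_def power_cancel d_def[symmetric])
      then have "card (W v) = (if \<pi> ^ (b + m) dvd \<pi> ^ d * (u * v) then card D ^ m else 0)"
        by (simp only: card_admissible_snd[OF s] m_def)
      with True yes show ?thesis by (simp only: e_iff) simp
    next
      case no: False
      then have "W v = {}" by (auto simp: W_def admissible_def)
      with no show ?thesis by auto
    qed
  next
    case False
    have "\<pi> ^ (b - d) dvd v" if "\<pi> ^ d * v = \<pi> ^ b * s" for s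
      using that by (simp flip: power_dvd_power_mult)
    with False have "W v = {}" by (auto simp: W_def admissible_def d_def[symmetric])
    with False show ?thesis by (simp add: e_iff)
  qed
  have card_V: "card V = (if min c e \<le> (a - b) + k then card D ^ (b - max c e) else 0)"
    unfolding V_def by (rule card_residues_cong_dvd[OF u \<open>c \<le> b\<close>]) (auto simp: e_def m_def)
  have "{(v, w). v \<in> residues b \<and> w \<in> residues c \<and> admissible A B a b c u v w} =
      (SIGMA v:residues b. W v)"
    by (auto simp: W_def)
  then have "card {(v, w). v \<in> residues b \<and> w \<in> residues c \<and> admissible A B a b c u v w} =
      (\<Sum>v\<in>residues b. card (W v))"
    by (simp add: card_SigmaI W_def)
  also have "\<dots> = (if c \<le> B - b + k then \<Sum>v\<in>V. card D ^ m else 0)"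
    unfolding card_W power_dvd_mult_valuation[OF u order_refl] V_def
      sum.inter_filter[OF finite_residues] by simp
  also have "\<dots> = hermite_pair_count (card D) (B - b) b c (A - a) (a - b) k"
    by (simp add: card_V hermite_pair_count_def Let_def e_def m_def d_def)
  finally show ?thesis .
qed

text \<open>The number of pairs (v, w) depends on u only through its capped valuation, so the u are
  grouped by it.\<close>

lemma card_admissible:
  assumes "c \<le> b"
  shows "card {(u, v, w). u \<in> residues c \<and> v \<in> residues b \<and> w \<in> residues c \<and>
      admissible A B a b c u v w} = hermite_count (card D) A B a b c"
proof -
  define val where "val u = (THE k. valuation_upto c u k)" for u
  have val: "valuation_upto c u k \<longleftrightarrow> val u = k" for u k
    using theI'[OF valuation_upto_ex1, of c u] valuation_upto_ex1[of c u]
    unfolding val_def by blast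
  have val_le: "val u \<le> c" for u
    using val[of u "val u"] by (auto simp: valuation_upto_def)
  let ?P = "\<lambda>u. {(v, w). v \<in> residues b \<and> w \<in> residues c \<and> admissible A B a b c u v w}"
  let ?N = "hermite_pair_count (card D) (B - b) b c (A - a) (a - b)"
  have fin: "finite (?P u)" for u
    by (rule finite_subset[of _ "residues b \<times> residues c"]) auto
  have "card {(u, v, w). u \<in> residues c \<and> v \<in> residues b \<and> w \<in> residues c \<and>
      admissible A B a b c u v w} = card (SIGMA u:residues c. ?P u)"
    by (rule arg_cong[where f = card]) auto
  also have "\<dots> = (\<Sum>u\<in>residues c. card (?P u))"
    using fin by (simp add: card_SigmaI)
  also have "\<dots> = (\<Sum>u\<in>residues c. ?N (val u))"
    by (intro sum.cong refl card_admissible_pairs assms) (simp add: val)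
  also have "\<dots> = (\<Sum>k\<le>c. \<Sum>u\<in>{u \<in> residues c. val u = k}. ?N (val u))"
    by (rule sum.group[symmetric]) (use val_le in auto)
  also have "\<dots> = (\<Sum>k\<le>c. card {u \<in> residues c. val u = k} * ?N k)"
    by simp
  also have "\<dots> = hermite_count (card D) A B a b c"
    unfolding hermite_count_def val[symmetric]
    by (intro sum.cong refl) (simp add: card_valuation_upto)
  finally show ?thesis .
qed

end

section \<open>Ideals containing the monomial ideal of a diagram\<close>

lemma module_mult: "module ((*) :: 'r::comm_ring_1 \<Rightarrow> 'r \<Rightarrow> 'r)"
  by unfold_locales (simp_all add: algebra_simps)

lemmas is_ideal_iff = module.subspace_def[OF module_mult]

lemma ideal_generated_subset_iff:
  "is_ideal J \<Longrightarrow> ideal_generated S \<subseteq> J \<longleftrightarrow> S \<subseteq> J"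
  using module.span_superset[OF module_mult, of S] module.span_minimal[OF module_mult, of S J]
  by blast

text \<open>Counting by representatives \<rho> indexed by X. Stated for additive subgroups, it
  applies to ideals and, later, to subspaces.\<close>

lemma card_cosets:
  fixes U :: "'v::ab_group_add set"
  assumes U: "0 \<in> U" "\<And>x y. x \<in> U \<Longrightarrow> y \<in> U \<Longrightarrow> x - y \<in> U"
    and inj: "\<And>x y. x \<in> X \<Longrightarrow> y \<in> X \<Longrightarrow> \<rho> x - \<rho> y \<in> U \<Longrightarrow> x = y"
    and surj: "\<And>f. \<exists>x\<in>X. f - \<rho> x \<in> U"
  shows "card (cosets U) = card X"
proof -
  let ?R = "{(f, g). f - g \<in> U}"
  have sym: "g - f \<in> U" if "f - g \<in> U" for f g
    using U(2)[OF U(1) that] by simp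
  have equiv: "equiv UNIV ?R"
  proof (intro equivI refl_onI symI transI)
    fix f g h assume "(f, g) \<in> ?R" "(g, h) \<in> ?R"
    then have "f - g \<in> U" "h - g \<in> U" using sym by auto
    from U(2)[OF this] have "(f - g) - (h - g) \<in> U" .
    then show "(f, h) \<in> ?R" by simp
  qed (use U(1) sym in auto)
  have "bij_betw (\<lambda>x. ?R `` {\<rho> x}) X (cosets U)"
  proof (rule bij_betwI')
    fix x y assume "x \<in> X" "y \<in> X"
    then show "?R `` {\<rho> x} = ?R `` {\<rho> y} \<longleftrightarrow> x = y"
      using inj U(1) by (subst eq_equiv_class_iff[OF equiv]) auto
  next
    fix Z assume "Z \<in> cosets U"
    then obtain f where f: "Z = ?R `` {f}" unfolding cosets_def by (rule quotientE)
    obtain x where "x \<in> X" "f - \<rho> x \<in> U" using surj by blast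
    then show "\<exists>x\<in>X. Z = ?R `` {\<rho> x}"
      unfolding f by (intro bexI[of _ x] equiv_class_eq[OF equiv]) auto
  qed (simp only: cosets_def quotientI UNIV_I)
  then show ?thesis by (rule bij_betw_same_card[symmetric])
qed

lemma ideal_diff: "is_ideal J \<Longrightarrow> x \<in> J \<Longrightarrow> y \<in> J \<Longrightarrow> x - y \<in> J"
  by (rule module.subspace_diff[OF module_mult])

section \<open>Ideals in Hermite normal form\<close>

lemma fps_mult_nth_2: "(f * g) $ 2 = f $ 0 * g $ 2 + f $ 1 * g $ 1 + f $ 2 * g $ 0"
  by (simp add: fps_mult_nth numeral_2_eq_2)

text \<open>A common shape for the generators of both ideals: \<pi> is the variable y in one case
  and p in the other.\<close>

definition diagram_gens :: "'r::comm_ring_1 \<Rightarrow> nat \<Rightarrow> nat \<Rightarrow> nat \<Rightarrow> 'r fps set" where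
  "diagram_gens \<pi> A B C = {fps_X ^ 3, fps_const (\<pi> ^ C) * fps_X ^ 2,
    fps_const (\<pi> ^ B) * fps_X, fps_const (\<pi> ^ A)}"

text \<open>The preimage, under reduction modulo x^3, of the span of the three rows. For arbitrary
  parameters it need not be an ideal; \<open>hermite_ideal_iff\<close> says when it is one
  containing the generators.\<close>

definition hermite_ideal :: "'r::comm_ring_1 \<Rightarrow> nat \<Rightarrow> nat \<Rightarrow> nat \<Rightarrow> 'r \<Rightarrow> 'r \<Rightarrow> 'r \<Rightarrow> 'r fps set" where
  "hermite_ideal \<pi> a b c u v w = {f. \<exists>r s t. f $ 0 = \<pi> ^ a * r \<and> f $ 1 = v * r + \<pi> ^ b * s \<and>
    f $ 2 = w * r + u * s + \<pi> ^ c * t}"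

definition quadratic :: "'r::comm_ring_1 \<Rightarrow> 'r \<Rightarrow> 'r \<Rightarrow> 'r fps" where
  "quadratic x y z = Abs_fps (\<lambda>n. if n = 0 then x else if n = 1 then y else if n = 2 then z else 0)"

lemma quadratic_nth [simp]:
  "quadratic x y z $ 0 = x" "quadratic x y z $ 1 = y" "quadratic x y z $ Suc 0 = y"
  "quadratic x y z $ 2 = z"
  by (simp_all add: quadratic_def)

text \<open>The difference g - f is a multiple of x^3. Membership in J can therefore be tested on
  quadratic polynomials.\<close>

lemma ideal_cong:
  fixes f g :: "'r::comm_ring_1 fps"
  assumes J: "is_ideal J" "fps_X ^ 3 \<in> J" and "f \<in> J"
    and "f $ 0 = g $ 0" "f $ 1 = g $ 1" "f $ 2 = g $ 2"
  shows "g \<in> J"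
proof -
  have "fps_cutoff 3 (g - f) = 0"
    using assms by (auto simp: fps_eq_iff eval_nat_numeral less_Suc_eq)
  then have "g - f = fps_shift 3 (g - f) * fps_X ^ 3"
    using fps_shift_cutoff[of 3 "g - f"] by simp
  then have "g = f + fps_shift 3 (g - f) * fps_X ^ 3"
    by (metis add_diff_cancel_left' diff_add_cancel add.commute)
  with J \<open>f \<in> J\<close> show ?thesis unfolding is_ideal_iff by metis
qed

context uniformizer
begin

text \<open>Take the least n with \<pi>^n in K. If x in K had valuation k < n, inverting its unit
  part modulo \<pi>^n would write \<pi>^k as a combination of x and \<pi>^n, contradicting
  minimality.\<close>

lemma power_in_ideal_dvd:
  assumes K: "is_ideal K" and N: "\<pi> ^ N \<in> K"
  shows "\<exists>n\<le>N. \<pi> ^ n \<in> K \<and> (\<forall>x\<in>K. \<pi> ^ n dvd x)"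
proof -
  define n where "n = (LEAST n. \<pi> ^ n \<in> K)"
  have n: "\<pi> ^ n \<in> K" unfolding n_def by (rule LeastI) (rule N)
  have least: "n \<le> k" if "\<pi> ^ k \<in> K" for k unfolding n_def by (rule Least_le) (rule that)
  have "\<pi> ^ n dvd x" if x: "x \<in> K" for x
  proof -
    obtain k where k: "valuation_upto n x k" using valuation_upto_ex1 by blast
    have "k = n"
    proof (rule ccontr)
      assume "k \<noteq> n"
      with k have "k < n" by (simp add: valuation_upto_def)
      with k obtain x' where x': "x = \<pi> ^ k * x'" "\<not> \<pi> dvd x'" by (rule valuation_upto_unit)
      obtain y z where "x' * y - 1 = \<pi> ^ n * z"
        using inverse_mod_power[OF x'(2)] by (metis dvdE)
      then have "x' * y - \<pi> ^ n * z = 1" by (simp add: algebra_simps)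
      moreover have "y * x + (- (\<pi> ^ k * z)) * \<pi> ^ n = \<pi> ^ k * (x' * y - \<pi> ^ n * z)"
        by (simp add: x'(1) algebra_simps)
      ultimately have "\<pi> ^ k = y * x + (- (\<pi> ^ k * z)) * \<pi> ^ n" by simp
      with K n x have "\<pi> ^ k \<in> K" unfolding is_ideal_iff by metis
      with least \<open>k < n\<close> show False by fastforce
    qed
    with k show ?thesis by (simp add: valuation_upto_def)
  qed
  with n least[OF N] show ?thesis by blast
qed

lemma mem_hermite_ideal_iff:
  assumes "f $ 0 = \<pi> ^ a * r"
  shows "f \<in> hermite_ideal \<pi> a b c u v w \<longleftrightarrow>
    (\<exists>s t. f $ 1 = v * r + \<pi> ^ b * s \<and> f $ 2 = w * r + u * s + \<pi> ^ c * t)"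
  using assms by (auto simp: hermite_ideal_def power_cancel)

lemma mem_hermite_ideal_0_iff:
  assumes "f $ 0 = 0"
  shows "f \<in> hermite_ideal \<pi> a b c u v w \<longleftrightarrow> (\<exists>s. f $ 1 = \<pi> ^ b * s \<and> \<pi> ^ c dvd f $ 2 - u * s)"
  using mem_hermite_ideal_iff[of f a 0 b c u v w] assms
  by (auto simp: dvd_def algebra_simps)

lemma mem_hermite_ideal_00_iff:
  assumes "f $ 0 = 0" "f $ 1 = 0"
  shows "f \<in> hermite_ideal \<pi> a b c u v w \<longleftrightarrow> \<pi> ^ c dvd f $ 2"
  using mem_hermite_ideal_0_iff[of f a b c u v w] assms by auto

text \<open>Closure under x is a matter of the first two rows, as x times the third vanishes modulo
  x^3. x times the second row lies in the span iff c \<le> b, and x times the first iff b \<le> a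
  and \<pi>^c divides v - \<pi>^(a - b) u. Generators are tested by solving for coefficients from
  the constant term upwards.\<close>

lemma hermite_ideal_iff:
  "is_ideal (hermite_ideal \<pi> a b c u v w) \<and> diagram_gens \<pi> A B C \<subseteq> hermite_ideal \<pi> a b c u v w \<longleftrightarrow>
    c \<le> b \<and> b \<le> a \<and> a \<le> A \<and> b \<le> B \<and> c \<le> C \<and> admissible A B a b c u v w"
  (is "is_ideal ?L \<and> _ \<longleftrightarrow> _")
proof -
  have gen3: "fps_X ^ 3 \<in> ?L"
    by (subst mem_hermite_ideal_00_iff) (simp_all add: fps_X_power_nth)
  have gen2: "fps_const (\<pi> ^ C) * fps_X ^ 2 \<in> ?L \<longleftrightarrow> c \<le> C"
    by (subst mem_hermite_ideal_00_iff) (simp_all add: fps_X_power_nth)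
  have gen1: "fps_const (\<pi> ^ B) * fps_X \<in> ?L \<longleftrightarrow> b \<le> B \<and> \<pi> ^ c dvd \<pi> ^ (B - b) * u"
  proof -
    have "fps_const (\<pi> ^ B) * fps_X \<in> ?L \<longleftrightarrow> (\<exists>s. \<pi> ^ B = \<pi> ^ b * s \<and> \<pi> ^ c dvd u * s)"
      by (subst mem_hermite_ideal_0_iff) simp_all
    also have "\<dots> \<longleftrightarrow> b \<le> B \<and> \<pi> ^ c dvd \<pi> ^ (B - b) * u"
    proof (cases "b \<le> B")
      case True
      then have "\<pi> ^ B = \<pi> ^ b * \<pi> ^ (B - b)" by (simp flip: power_add)
      then have "\<pi> ^ B = \<pi> ^ b * s \<longleftrightarrow> s = \<pi> ^ (B - b)" for s
        using power_cancel by metis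
      with True show ?thesis by (simp add: mult.commute)
    next
      case False
      then have "\<not> \<pi> ^ b dvd \<pi> ^ B" by simp
      with False show ?thesis by (auto simp del: power_dvd_power_iff)
    qed
    finally show ?thesis .
  qed
  have gen0: "fps_const (\<pi> ^ A) \<in> ?L \<longleftrightarrow> a \<le> A \<and>
      (\<exists>s. \<pi> ^ (A - a) * v = \<pi> ^ b * s \<and> \<pi> ^ c dvd \<pi> ^ (A - a) * w - s * u)"
  proof (cases "a \<le> A")
    case True
    then have "\<pi> ^ A = \<pi> ^ a * \<pi> ^ (A - a)" by (simp flip: power_add)
    then have "fps_const (\<pi> ^ A) \<in> ?L \<longleftrightarrow> (\<exists>s t. 0 = v * \<pi> ^ (A - a) + \<pi> ^ b * s \<and>
        0 = w * \<pi> ^ (A - a) + u * s + \<pi> ^ c * t)"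
      by (subst mem_hermite_ideal_iff[where r = "\<pi> ^ (A - a)"]) simp_all
    also have "\<dots> \<longleftrightarrow> (\<exists>s t. \<pi> ^ (A - a) * v = \<pi> ^ b * (- s) \<and>
        \<pi> ^ (A - a) * w - (- s) * u = \<pi> ^ c * (- t))"
      by (simp add: eq_neg_iff_add_eq_0 algebra_simps eq_commute[of 0])
    also have "\<dots> \<longleftrightarrow> (\<exists>s t. \<pi> ^ (A - a) * v = \<pi> ^ b * s \<and> \<pi> ^ (A - a) * w - s * u = \<pi> ^ c * t)"
      by (metis minus_minus)
    finally show ?thesis using True by (auto simp: dvd_def)
  next
    case False
    then have "\<not> \<pi> ^ a dvd \<pi> ^ A" by simp
    with False show ?thesis by (auto simp: hermite_ideal_def simp del: power_dvd_power_iff)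
  qed
  have ideal_iff: "is_ideal ?L \<longleftrightarrow> c \<le> b \<and> b \<le> a \<and> \<pi> ^ c dvd v - \<pi> ^ (a - b) * u"
  proof
    assume L: "is_ideal ?L"
    have "quadratic 0 (\<pi> ^ b) u \<in> ?L" (is "?g \<in> _")
      by (subst mem_hermite_ideal_0_iff) (auto intro: exI[of _ 1])
    with L have "fps_X * ?g \<in> ?L" by (simp only: is_ideal_iff)
    then have "c \<le> b"
      by (subst (asm) mem_hermite_ideal_00_iff) (simp_all add: numeral_2_eq_2)
    have "quadratic (\<pi> ^ a) v w \<in> ?L" (is "?f \<in> _")
      by (subst mem_hermite_ideal_iff[of _ _ 1]) (auto intro!: exI[of _ 0])
    with L have "fps_X * ?f \<in> ?L" by (simp only: is_ideal_iff)
    then obtain s where s: "\<pi> ^ a = \<pi> ^ b * s" "\<pi> ^ c dvd v - u * s"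
      by (subst (asm) mem_hermite_ideal_0_iff) (auto simp: numeral_2_eq_2)
    from s(1) have "\<pi> ^ b dvd \<pi> ^ a" by (rule dvdI)
    then have ba: "b \<le> a" by simp
    then have "\<pi> ^ a = \<pi> ^ b * \<pi> ^ (a - b)" by (simp flip: power_add)
    with s(1) have "s = \<pi> ^ (a - b)" by (metis power_cancel)
    with s(2) ba \<open>c \<le> b\<close> show "c \<le> b \<and> b \<le> a \<and> \<pi> ^ c dvd v - \<pi> ^ (a - b) * u"
      by (simp add: mult.commute)
  next
    assume *: "c \<le> b \<and> b \<le> a \<and> \<pi> ^ c dvd v - \<pi> ^ (a - b) * u"
    define \<beta> \<gamma> where "\<beta> = \<pi> ^ (a - b)" and "\<gamma> = \<pi> ^ (b - c)"
    from * have \<beta>: "\<pi> ^ a = \<pi> ^ b * \<beta>" and \<gamma>: "\<pi> ^ b = \<pi> ^ c * \<gamma>"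
      unfolding \<beta>_def \<gamma>_def by (simp_all flip: power_add)
    from * obtain z where "v - \<pi> ^ (a - b) * u = \<pi> ^ c * z" by (auto elim: dvdE)
    then have v: "v = \<beta> * u + \<pi> ^ c * z" by (simp add: \<beta>_def algebra_simps)
    have add: "f + g \<in> ?L" if fg: "f \<in> ?L" "g \<in> ?L" for f g
    proof -
      from fg obtain r s t r' s' t' where
        "f $ 0 = \<pi> ^ a * r" "f $ 1 = v * r + \<pi> ^ b * s" "f $ 2 = w * r + u * s + \<pi> ^ c * t"
        "g $ 0 = \<pi> ^ a * r'" "g $ 1 = v * r' + \<pi> ^ b * s'" "g $ 2 = w * r' + u * s' + \<pi> ^ c * t'"
        unfolding hermite_ideal_def by blast
      then have "(f + g) $ 0 = \<pi> ^ a * (r + r') \<and> (f + g) $ 1 = v * (r + r') + \<pi> ^ b * (s + s') \<and>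
          (f + g) $ 2 = w * (r + r') + u * (s + s') + \<pi> ^ c * (t + t')"
        by (simp add: algebra_simps)
      then show ?thesis unfolding hermite_ideal_def by blast
    qed
    have mult: "g * f \<in> ?L" if f: "f \<in> ?L" for f g
    proof -
      from f obtain r s t where
        "f $ 0 = \<pi> ^ a * r" "f $ 1 = v * r + \<pi> ^ b * s" "f $ 2 = w * r + u * s + \<pi> ^ c * t"
        unfolding hermite_ideal_def by blast
      \<comment> \<open>The coefficients come from multiplication by x modulo x^3: the first row
        goes to \<beta> times the second plus z times the third, and the second to \<gamma> times
        the third.\<close>
      then have "(g * f) $ 0 = \<pi> ^ a * (g $ 0 * r) \<and>
          (g * f) $ 1 = v * (g $ 0 * r) + \<pi> ^ b * (g $ 0 * s + g $ 1 * \<beta> * r) \<and>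
          (g * f) $ 2 = w * (g $ 0 * r) + u * (g $ 0 * s + g $ 1 * \<beta> * r) +
            \<pi> ^ c * (g $ 0 * t + g $ 1 * z * r + g $ 1 * \<gamma> * s + g $ 2 * \<gamma> * \<beta> * r)"
        unfolding fps_mult_nth_0 fps_mult_nth_1 fps_mult_nth_2
        by (simp add: \<beta> \<gamma> v algebra_simps)
      then show ?thesis unfolding hermite_ideal_def by blast
    qed
    have "0 \<in> ?L" by (subst mem_hermite_ideal_00_iff) simp_all
    with add mult show "is_ideal ?L" unfolding is_ideal_iff by blast
  qed
  show ?thesis
    unfolding ideal_iff diagram_gens_def insert_subset gen2 gen1 gen0 admissible_def
    using gen3 by blast
qed

text \<open>Each row of one form lies in the span of the other. Comparing leading coefficients both
  ways gives the exponents; the remaining entries are then congruent, and residues are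
  unique.\<close>

lemma hermite_ideal_inject:
  assumes eq: "hermite_ideal \<pi> a b c u v w = hermite_ideal \<pi> a' b' c' u' v' w'"
    and mem: "u \<in> residues c" "v \<in> residues b" "w \<in> residues c"
      "u' \<in> residues c'" "v' \<in> residues b'" "w' \<in> residues c'"
  shows "a = a' \<and> b = b' \<and> c = c' \<and> u = u' \<and> v = v' \<and> w = w'"
proof -
  let ?L = "hermite_ideal \<pi> a b c u v w" and ?L' = "hermite_ideal \<pi> a' b' c' u' v' w'"
  have mem0: "quadratic (\<pi> ^ a) v w \<in> hermite_ideal \<pi> a b c u v w" for a b c u v w
    by (subst mem_hermite_ideal_iff[of _ _ 1]) (auto simp only: quadratic_nth intro!: exI[of _ 0], simp_all)
  have mem1: "quadratic 0 (\<pi> ^ b) u \<in> hermite_ideal \<pi> a b c u v w" for a b c u v w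
    by (subst mem_hermite_ideal_0_iff) (auto simp only: quadratic_nth intro!: exI[of _ 1], simp_all)
  have mem2: "quadratic 0 0 (\<pi> ^ c) \<in> hermite_ideal \<pi> a b c u v w" for a b c u v w
    by (subst mem_hermite_ideal_00_iff) (simp_all only: quadratic_nth dvd_refl)
  have le0: "a \<le> a'" if "quadratic (\<pi> ^ a') v' w' \<in> hermite_ideal \<pi> a b c u v w" for a a' b c u v w v' w'
  proof -
    have "\<pi> ^ a dvd \<pi> ^ a'" using that unfolding hermite_ideal_def quadratic_nth mem_Collect_eq by (metis dvdI)
    then show ?thesis by simp
  qed
  have le1: "b \<le> b'" if "quadratic 0 (\<pi> ^ b') u' \<in> hermite_ideal \<pi> a b c u v w" for a b b' c u v w u'
  proof -
    have "\<pi> ^ b dvd \<pi> ^ b'"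
      using that by (subst (asm) mem_hermite_ideal_0_iff) (simp_all only: quadratic_nth, metis dvdI)
    then show ?thesis by simp
  qed
  have le2: "c \<le> c'" if "quadratic 0 0 (\<pi> ^ c') \<in> hermite_ideal \<pi> a b c u v w" for a b c c' u v w
    using that by (subst (asm) mem_hermite_ideal_00_iff) (simp_all only: quadratic_nth power_dvd_power_iff)
  have a: "a' = a" using mem0 le0 eq by (metis order_antisym)
  have b: "b' = b" using mem1 le1 eq by (metis order_antisym)
  have c: "c' = c" using mem2 le2 eq by (metis order_antisym)
  have "quadratic 0 (\<pi> ^ b) u' \<in> ?L" using mem1[of b' u'] unfolding eq b by simp
  then have "\<pi> ^ c dvd u' - u"
    by (subst (asm) mem_hermite_ideal_0_iff) (auto simp only: quadratic_nth power_cancel mult_1_right dest!: power_cancel[of b 1, simplified, THEN iffD1])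
  then have u: "u' = u" using residue_eq mem c by metis
  have "quadratic (\<pi> ^ a) v' w' \<in> ?L" using mem0[of a' v' w'] unfolding eq a by simp
  then obtain s t where st: "v' = v + \<pi> ^ b * s" "w' = w + u * s + \<pi> ^ c * t"
    by (subst (asm) mem_hermite_ideal_iff[of _ _ 1]) (auto simp only: quadratic_nth mult_1_right)
  then have "\<pi> ^ b dvd v' - v" by simp
  then have v: "v' = v" using residue_eq mem b by metis
  \<comment> \<open>The second row is not involved once v is known, because \<pi>^b is a
    non-zero-divisor; only then is w determined modulo \<pi>^c.\<close>
  with st have "s = 0" by simp
  with st have "\<pi> ^ c dvd w' - w" by simp
  then have "w' = w" using residue_eq mem c by metis
  with a b c u v show ?thesis by simp
qed

end

text \<open>The common value of both sums: the ring enters only through q.\<close>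

definition hermite_sum :: "nat \<Rightarrow> nat \<Rightarrow> nat \<Rightarrow> nat \<Rightarrow> int poly" where
  "hermite_sum q A B C = (\<Sum>(a, b, c) | c \<le> b \<and> b \<le> a \<and> a \<le> A \<and> b \<le> B \<and> c \<le> C.
    of_nat (hermite_count q A B a b c) * monom 1 (a + b + c))"

section \<open>Enumeration of the ideals and of their colengths\<close>

context uniformizer
begin

text \<open>Elimination: the leading coefficients in each degree form an ideal of R generated by a
  power of \<pi>. Lifting these generators gives three rows, whose other entries are reduced by the
  rows below.\<close>

lemma hermite_ideal_ex:
  assumes J: "is_ideal J" and gens: "diagram_gens \<pi> A B C \<subseteq> J"
  shows "\<exists>a b c. \<exists>u\<in>residues c. \<exists>v\<in>residues b. \<exists>w\<in>residues c. J = hermite_ideal \<pi> a b c u v w"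
proof -
  have J3: "fps_X ^ 3 \<in> J" using gens by (simp add: diagram_gens_def)
  have J0: "0 \<in> J" and J_add: "\<And>x y. x \<in> J \<Longrightarrow> y \<in> J \<Longrightarrow> x + y \<in> J"
    and J_mult: "\<And>x y. y \<in> J \<Longrightarrow> x * y \<in> J"
    using J by (simp_all add: is_ideal_iff)
  \<comment> \<open>The leading-coefficient ideals for orders 0, 1 and 2 in x.\<close>
  define K0 K1 K2 where "K0 = {x. \<exists>y z. quadratic x y z \<in> J}"
    and "K1 = {y. \<exists>z. quadratic 0 y z \<in> J}" and "K2 = {z. quadratic 0 0 z \<in> J}"
  have quad_0: "quadratic 0 0 0 \<in> J"
    by (rule ideal_cong[OF J J3 J0]) simp_all
  have quad_add: "quadratic (x + x') (y + y') (z + z') \<in> J"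
    if "quadratic x y z \<in> J" "quadratic x' y' z' \<in> J" for x y z x' y' z'
    by (rule ideal_cong[OF J J3 J_add[OF that]]) simp_all
  have quad_mult: "quadratic (k * x) (k * y) (k * z) \<in> J"
    if "quadratic x y z \<in> J" for k x y z
    by (rule ideal_cong[OF J J3 J_mult[OF that, of "fps_const k"]]) simp_all
  note quad_add_0 = quad_add[of 0 _ _ 0, simplified] quad_add[of 0 0 _ 0 0, simplified]
  note quad_mult_0 = quad_mult[of 0, simplified] quad_mult[of 0 0, simplified]
  have K0: "is_ideal K0"
    unfolding is_ideal_iff K0_def using quad_0 quad_add quad_mult by blast
  have K1: "is_ideal K1"
    unfolding is_ideal_iff K1_def using quad_0 quad_add_0(1) quad_mult_0(1) by blast
  have K2: "is_ideal K2"
    unfolding is_ideal_iff K2_def using quad_0 quad_add_0(2) quad_mult_0(2) by blast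
  have powers: "\<pi> ^ A \<in> K0" "\<pi> ^ B \<in> K1" "\<pi> ^ C \<in> K2"
  proof -
    have "quadratic (\<pi> ^ A) 0 0 \<in> J"
      by (rule ideal_cong[OF J J3, of "fps_const (\<pi> ^ A)"]) (use gens in \<open>simp_all add: diagram_gens_def\<close>)
    moreover have "quadratic 0 (\<pi> ^ B) 0 \<in> J"
      by (rule ideal_cong[OF J J3, of "fps_const (\<pi> ^ B) * fps_X"])
         (use gens in \<open>simp_all add: diagram_gens_def\<close>)
    moreover have "quadratic 0 0 (\<pi> ^ C) \<in> J"
      by (rule ideal_cong[OF J J3, of "fps_const (\<pi> ^ C) * fps_X ^ 2"])
         (use gens in \<open>simp_all add: diagram_gens_def fps_X_power_nth\<close>)
    ultimately show "\<pi> ^ A \<in> K0" "\<pi> ^ B \<in> K1" "\<pi> ^ C \<in> K2"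
      by (auto simp: K0_def K1_def K2_def)
  qed
  obtain a where a: "\<pi> ^ a \<in> K0" "\<forall>x\<in>K0. \<pi> ^ a dvd x"
    using power_in_ideal_dvd[OF K0 powers(1)] by blast
  obtain b where b: "\<pi> ^ b \<in> K1" "\<forall>x\<in>K1. \<pi> ^ b dvd x"
    using power_in_ideal_dvd[OF K1 powers(2)] by blast
  obtain c where c: "\<pi> ^ c \<in> K2" "\<forall>x\<in>K2. \<pi> ^ c dvd x"
    using power_in_ideal_dvd[OF K2 powers(3)] by blast
  have h: "quadratic 0 0 (k * \<pi> ^ c) \<in> J" for k
    using quad_mult[of 0 0 "\<pi> ^ c" k] c by (simp add: K2_def)
  obtain u0 where u0: "quadratic 0 (\<pi> ^ b) u0 \<in> J" using b by (auto simp: K1_def)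
  obtain u where u: "u \<in> residues c" "\<pi> ^ c dvd u0 - u" using residue_ex by blast
  then obtain k where "u0 - u = \<pi> ^ c * k" by (auto elim: dvdE)
  with quad_add[OF u0 h[of "- k"]] have g: "quadratic 0 (\<pi> ^ b) u \<in> J"
    by (simp add: algebra_simps)
  obtain v0 w0 where vw0: "quadratic (\<pi> ^ a) v0 w0 \<in> J" using a by (auto simp: K0_def)
  obtain v where v: "v \<in> residues b" "\<pi> ^ b dvd v0 - v" using residue_ex by blast
  then obtain l where l: "v0 - v = \<pi> ^ b * l" by (auto elim: dvdE)
  \<comment> \<open>Reducing v0 to v subtracts l times the second row, which changes the x^2
    coefficient by l u.\<close>
  obtain w where w: "w \<in> residues c" "\<pi> ^ c dvd (w0 - l * u) - w" using residue_ex by blast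
  then obtain m where "(w0 - l * u) - w = \<pi> ^ c * m" by (auto elim: dvdE)
  with l quad_add[OF quad_add[OF vw0 quad_mult[OF g, of "- l"]] h[of "- m"]]
  have f: "quadratic (\<pi> ^ a) v w \<in> J"
    by (simp add: algebra_simps)
  have "J = hermite_ideal \<pi> a b c u v w"
  proof (intro equalityI subsetI)
    fix F assume "F \<in> hermite_ideal \<pi> a b c u v w"
    then obtain r s t where F: "F $ 0 = \<pi> ^ a * r" "F $ 1 = v * r + \<pi> ^ b * s"
      "F $ 2 = w * r + u * s + \<pi> ^ c * t"
      unfolding hermite_ideal_def by blast
    show "F \<in> J"
      by (rule ideal_cong[OF J J3 quad_add[OF quad_add[OF quad_mult[OF f, of r] quad_mult[OF g, of s]] h[of t]]])
         (simp_all only: F quadratic_nth, simp_all add: algebra_simps)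
  next
    fix F assume "F \<in> J"
    then have F: "quadratic (F $ 0) (F $ 1) (F $ 2) \<in> J"
      by (rule ideal_cong[OF J J3]) simp_all
    \<comment> \<open>Division by the rows from the top: r, s and t clear the coefficients in
      turn.\<close>
    then obtain r where r: "F $ 0 = \<pi> ^ a * r"
      using a(2) by (auto simp: K0_def elim!: dvdE)
    have F1: "quadratic 0 (F $ 1 - v * r) (F $ 2 - w * r) \<in> J"
      using quad_add[OF F quad_mult[OF f, of "- r"]] by (simp add: r algebra_simps)
    then have "\<pi> ^ b dvd F $ 1 - v * r" using b(2) unfolding K1_def by blast
    then obtain s where s: "F $ 1 - v * r = \<pi> ^ b * s" ..
    have "quadratic (0 + - s * 0) (F $ 1 - v * r + - s * \<pi> ^ b) (F $ 2 - w * r + - s * u) \<in> J"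
      by (rule quad_add[OF F1 quad_mult[OF g]])
    then have "quadratic 0 0 (F $ 2 - w * r - u * s) \<in> J"
      unfolding s by (simp add: mult.commute)
    then have "\<pi> ^ c dvd F $ 2 - w * r - u * s" using c(2) unfolding K2_def by blast
    then obtain t where t: "F $ 2 - w * r - u * s = \<pi> ^ c * t" ..
    have "F $ 1 = v * r + \<pi> ^ b * s" "F $ 2 = w * r + u * s + \<pi> ^ c * t"
      using s t by (simp_all only: diff_eq_eq add_ac)
    with r show "F \<in> hermite_ideal \<pi> a b c u v w" unfolding hermite_ideal_def by blast
  qed
  with u v w show ?thesis by blast
qed

text \<open>The rows are triangular with diagonal \<pi>^a, \<pi>^b, \<pi>^c, so the quadratics with
  coefficients reduced modulo these powers represent each coset once.\<close>

lemma card_cosets_hermite_ideal: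
  assumes "is_ideal (hermite_ideal \<pi> a b c u v w)"
  shows "card (cosets (hermite_ideal \<pi> a b c u v w)) = card D ^ (a + b + c)"
proof -
  let ?L = "hermite_ideal \<pi> a b c u v w"
  let ?X = "residues a \<times> residues b \<times> residues c"
  have "card (cosets ?L) = card ?X"
  proof (rule card_cosets[where \<rho> = "\<lambda>(x, y, z). quadratic x y z"])
    show "0 \<in> ?L" using assms by (simp add: is_ideal_iff)
  next
    fix f g assume "f \<in> ?L" "g \<in> ?L"
    then show "f - g \<in> ?L" by (rule ideal_diff[OF assms])
  next
    fix X Y
    assume XY: "X \<in> ?X" "Y \<in> ?X"
      and diff: "(case X of (x, y, z) \<Rightarrow> quadratic x y z) - (case Y of (x, y, z) \<Rightarrow> quadratic x y z) \<in> ?L"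
    obtain x y z x' y' z' where X: "X = (x, y, z)" and Y: "Y = (x', y', z')"
      by (metis prod.exhaust)
    from XY have mem: "x \<in> residues a" "y \<in> residues b" "z \<in> residues c"
      "x' \<in> residues a" "y' \<in> residues b" "z' \<in> residues c"
      by (auto simp: X Y)
    let ?f = "quadratic x y z - quadratic x' y' z'"
    from diff have f: "?f \<in> ?L" by (simp add: X Y)
    then have "\<pi> ^ a dvd x - x'" by (auto simp: hermite_ideal_def)
    then have x: "x = x'" using residue_eq mem by blast
    then obtain s where s: "y - y' = \<pi> ^ b * s" "\<pi> ^ c dvd (z - z') - u * s"
      using f by (auto simp: mem_hermite_ideal_0_iff)
    then have "y = y'" using residue_eq mem by (metis dvdI)
    moreover from this s have "\<pi> ^ c dvd z - z'" by simp
    then have "z = z'" using residue_eq mem by blast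
    ultimately show "X = Y" by (simp add: X Y x)
  next
    fix f :: "'r fps"
    obtain x where x: "x \<in> residues a" "\<pi> ^ a dvd f $ 0 - x" using residue_ex by blast
    then obtain r where r: "f $ 0 - x = \<pi> ^ a * r" by (auto elim: dvdE)
    obtain y where y: "y \<in> residues b" "\<pi> ^ b dvd (f $ 1 - v * r) - y" using residue_ex by blast
    then obtain s where s: "(f $ 1 - v * r) - y = \<pi> ^ b * s" by (auto elim: dvdE)
    obtain z where z: "z \<in> residues c" "\<pi> ^ c dvd (f $ 2 - w * r - u * s) - z"
      using residue_ex by blast
    then obtain t where t: "(f $ 2 - w * r - u * s) - z = \<pi> ^ c * t" by (auto elim: dvdE)
    have "(f - quadratic x y z) $ 0 = \<pi> ^ a * r"
      "(f - quadratic x y z) $ 1 = v * r + \<pi> ^ b * s"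
      "(f - quadratic x y z) $ 2 = w * r + u * s + \<pi> ^ c * t"
      by (simp_all flip: r s t)
    then have "f - quadratic x y z \<in> ?L" unfolding hermite_ideal_def by blast
    with x y z show "\<exists>X\<in>?X. f - (case X of (x, y, z) \<Rightarrow> quadratic x y z) \<in> ?L"
      by (intro bexI[of _ "(x, y, z)"]) auto
  qed
  then show ?thesis by (simp add: card_cartesian_product card_residues power_add mult.assoc)
qed

text \<open>Normal forms biject with the ideals. An abstract \<open>len\<close> that reads n off q^n
  covers both the dimension and the logarithm.\<close>

lemma sum_ideals_eq_hermite_sum:
  fixes len :: "'r fps set \<Rightarrow> nat"
  assumes len: "\<And>J n. is_ideal J \<Longrightarrow> card (cosets J) = card D ^ n \<Longrightarrow> len J = n"
  shows "(\<Sum>J | is_ideal J \<and> diagram_gens \<pi> A B C \<subseteq> J. monom (1::int) (len J)) =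
    hermite_sum (card D) A B C"
proof -
  define S where "S = {(a, b, c). c \<le> b \<and> b \<le> a \<and> a \<le> A \<and> b \<le> B \<and> c \<le> C}"
  define P where "P = (\<lambda>(a, b, c). {(u, v, w). u \<in> residues c \<and> v \<in> residues b \<and> w \<in> residues c \<and>
    admissible A B a b c u v w})"
  define \<Phi> where "\<Phi> = (\<lambda>((a, b, c), u, v, w). hermite_ideal \<pi> a b c u v w)"
  have fin_S: "finite S"
    by (rule finite_subset[of _ "{..A} \<times> {..B} \<times> {..C}"]) (auto simp: S_def)
  have fin_P: "finite (P i)" for i
    by (cases i, rule finite_subset[of _ "residues (snd (snd i)) \<times> residues (fst (snd i)) \<times> residues (snd (snd i))"])
       (auto simp: P_def)
  have bij: "bij_betw \<Phi> (Sigma S P) {J. is_ideal J \<and> diagram_gens \<pi> A B C \<subseteq> J}"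
  proof (rule bij_betw_imageI)
    show "inj_on \<Phi> (Sigma S P)"
      by (intro inj_onI) (auto simp: \<Phi>_def P_def dest!: hermite_ideal_inject)
    show "\<Phi> ` Sigma S P = {J. is_ideal J \<and> diagram_gens \<pi> A B C \<subseteq> J}"
    proof (intro equalityI subsetI)
      fix J assume "J \<in> \<Phi> ` Sigma S P"
      then obtain a b c u v w where
        "(a, b, c) \<in> S" "(u, v, w) \<in> P (a, b, c)" "J = hermite_ideal \<pi> a b c u v w"
        by (auto simp: \<Phi>_def)
      then show "J \<in> {J. is_ideal J \<and> diagram_gens \<pi> A B C \<subseteq> J}"
        using hermite_ideal_iff[of a b c u v w A B C] by (simp add: P_def S_def)
    next
      fix J assume J: "J \<in> {J. is_ideal J \<and> diagram_gens \<pi> A B C \<subseteq> J}"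
      then obtain a b c u v w where mem: "u \<in> residues c" "v \<in> residues b" "w \<in> residues c"
        and eq: "J = hermite_ideal \<pi> a b c u v w"
        using hermite_ideal_ex by blast
      from J have "((a, b, c), u, v, w) \<in> Sigma S P"
        using hermite_ideal_iff[of a b c u v w A B C] mem by (simp add: eq S_def P_def)
      then show "J \<in> \<Phi> ` Sigma S P" unfolding eq by (force simp: \<Phi>_def)
    qed
  qed
  have len_\<Phi>: "len (\<Phi> ((a, b, c), u, v, w)) = a + b + c"
    if "(a, b, c) \<in> S" "(u, v, w) \<in> P (a, b, c)" for a b c u v w
  proof -
    from that have "is_ideal (hermite_ideal \<pi> a b c u v w)"
      using hermite_ideal_iff[of a b c u v w A B C] by (simp add: S_def P_def)
    then show ?thesis
      unfolding \<Phi>_def by (simp add: len card_cosets_hermite_ideal)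
  qed
  have "(\<Sum>J | is_ideal J \<and> diagram_gens \<pi> A B C \<subseteq> J. monom (1::int) (len J)) =
      (\<Sum>x\<in>Sigma S P. monom 1 (len (\<Phi> x)))"
    by (rule sum.reindex_bij_betw[OF bij, symmetric])
  also have "\<dots> = (\<Sum>i\<in>S. \<Sum>j\<in>P i. monom 1 (len (\<Phi> (i, j))))"
    using fin_S fin_P by (subst sum.Sigma) auto
  also have "\<dots> = (\<Sum>(a, b, c)\<in>S. of_nat (hermite_count (card D) A B a b c) * monom 1 (a + b + c))"
  proof (intro sum.cong refl, clarify)
    fix a b c assume S: "(a, b, c) \<in> S"
    then have "card (P (a, b, c)) = hermite_count (card D) A B a b c"
      using card_admissible[of c b A B a] by (simp add: S_def P_def)
    moreover have "(\<Sum>j\<in>P (a, b, c). monom (1::int) (len (\<Phi> ((a, b, c), j)))) =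
        (\<Sum>j\<in>P (a, b, c). monom 1 (a + b + c))"
      using len_\<Phi>[OF S] by (intro sum.cong refl) auto
    ultimately show "(\<Sum>j\<in>P (a, b, c). monom (1::int) (len (\<Phi> ((a, b, c), j)))) =
        of_nat (hermite_count (card D) A B a b c) * monom 1 (a + b + c)"
      by simp
  qed
  finally show ?thesis unfolding hermite_sum_def S_def .
qed

end

section \<open>Dimension and length of finite quotients\<close>

lemma card_supported_functions:
  assumes "finite B"
  shows "card {c. \<forall>b. b \<notin> B \<longrightarrow> c b = (0::'k::{finite,zero})} = CARD('k) ^ card B"
proof -
  have "bij_betw (\<lambda>f b. if b \<in> B then f b else 0) (B \<rightarrow>\<^sub>E (UNIV :: 'k set))
      {c. \<forall>b. b \<notin> B \<longrightarrow> c b = 0}"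
    by (rule bij_betw_byWitness[where f' = "\<lambda>c. restrict c B"]) (auto simp: fun_eq_iff PiE_def extensional_def)
  from bij_betw_same_card[OF this] show ?thesis using assms by (simp add: card_PiE)
qed

text \<open>A set of least cardinality among those spanning modulo U is a basis: a nontrivial
  relation would allow one vector to be dropped.\<close>

lemma quotient_basis_ex:
  fixes scale :: "'k::field \<Rightarrow> 'v::ab_group_add \<Rightarrow> 'v"
  assumes "vector_space scale" and U: "module.subspace scale U" and fin: "finite (cosets U)"
  shows "\<exists>B. quotient_basis scale U B"
proof -
  interpret vector_space scale by fact
  define spanning where "spanning B \<longleftrightarrow> finite B \<and>
    (\<forall>v. \<exists>c. (\<forall>b. b \<notin> B \<longrightarrow> c b = 0) \<and> v - (\<Sum>b\<in>B. scale (c b) b) \<in> U)" for B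
  have "\<exists>B. spanning B"
  proof
    \<comment> \<open>One representative from each of the finitely many cosets spans, with a single
      coefficient 1.\<close>
    let ?B = "(\<lambda>Z. SOME z. z \<in> Z) ` cosets U"
    show "spanning ?B"
      unfolding spanning_def
    proof (intro conjI allI)
      show "finite ?B" using fin by simp
      fix v
      let ?Z = "{(f, g). f - g \<in> U} `` {v}" and ?b = "SOME z. z \<in> {(f, g). f - g \<in> U} `` {v}"
      have "v \<in> ?Z" using subspace_0[OF U] by simp
      then have "?b \<in> ?Z" by (rule someI)
      then have "v - ?b \<in> U" by simp
      moreover have B: "?b \<in> ?B"
        unfolding cosets_def by (intro imageI quotientI UNIV_I)
      have "(\<Sum>b\<in>?B. scale (if b = ?b then 1 else 0) b) = (\<Sum>b\<in>?B. if b = ?b then b else 0)"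
        by (intro sum.cong refl) auto
      then have "(\<Sum>b\<in>?B. scale (if b = ?b then 1 else 0) b) = ?b"
        using fin B by (simp only: sum.delta finite_imageI if_True)
      ultimately show "\<exists>c. (\<forall>b. b \<notin> ?B \<longrightarrow> c b = 0) \<and> v - (\<Sum>b\<in>?B. scale (c b) b) \<in> U"
        using B by (intro exI[of _ "\<lambda>b. if b = ?b then 1 else 0"]) auto
    qed
  qed
  then obtain B where B: "spanning B" and min: "\<And>B'. spanning B' \<Longrightarrow> card B \<le> card B'"
    using ex_has_least_nat[of spanning _ card] by blast
  then have finB: "finite B" by (simp add: spanning_def)
  have indep: "d b0 = 0" if b0: "b0 \<in> B" and d: "(\<Sum>b\<in>B. scale (d b) b) \<in> U" for d b0
  proof (rule ccontr)
    assume nz: "d b0 \<noteq> 0"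
    have "spanning (B - {b0})"
      unfolding spanning_def
    proof (intro conjI allI)
      fix v
      obtain c where c: "\<forall>b. b \<notin> B \<longrightarrow> c b = 0" "v - (\<Sum>b\<in>B. scale (c b) b) \<in> U"
        using B unfolding spanning_def by blast
      \<comment> \<open>Subtracting this multiple of the relation \<open>d\<close> makes the
        coefficient of b0 vanish without leaving the coset.\<close>
      define c' where "c' b = (if b \<in> B then c b - c b0 / d b0 * d b else 0)" for b
      have c'0: "c' b0 = 0" using nz by (simp add: c'_def)
      have "(\<Sum>b\<in>B - {b0}. scale (c' b) b) = (\<Sum>b\<in>B. scale (c' b) b)"
        using finB b0 c'0 by (simp add: sum.remove)
      also have "\<dots> = (\<Sum>b\<in>B. scale (c b) b) - scale (c b0 / d b0) (\<Sum>b\<in>B. scale (d b) b)"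
        by (simp add: c'_def scale_left_diff_distrib sum_subtractf scale_sum_right)
      finally have eq: "v - (\<Sum>b\<in>B - {b0}. scale (c' b) b) =
          (v - (\<Sum>b\<in>B. scale (c b) b)) + scale (c b0 / d b0) (\<Sum>b\<in>B. scale (d b) b)"
        by simp
      have "v - (\<Sum>b\<in>B - {b0}. scale (c' b) b) \<in> U"
        unfolding eq by (intro subspace_add[OF U] subspace_scale[OF U] c d)
      moreover have "\<forall>b. b \<notin> B - {b0} \<longrightarrow> c' b = 0"
        using c'0 by (auto simp: c'_def)
      ultimately show "\<exists>c. (\<forall>b. b \<notin> B - {b0} \<longrightarrow> c b = 0) \<and>
          v - (\<Sum>b\<in>B - {b0}. scale (c b) b) \<in> U" by blast
    qed (use finB in simp)
    from min[OF this] finB b0 show False by (metis card_Diff1_less not_less)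
  qed
  have "quotient_basis scale U B"
    unfolding quotient_basis_def
  proof (intro conjI allI ex_ex1I)
    fix v c c'
    assume c: "(\<forall>b. b \<notin> B \<longrightarrow> c b = 0) \<and> v - (\<Sum>b\<in>B. scale (c b) b) \<in> U"
      and c': "(\<forall>b. b \<notin> B \<longrightarrow> c' b = 0) \<and> v - (\<Sum>b\<in>B. scale (c' b) b) \<in> U"
    have "(v - (\<Sum>b\<in>B. scale (c' b) b)) - (v - (\<Sum>b\<in>B. scale (c b) b)) \<in> U"
      by (rule subspace_diff[OF U conjunct2[OF c'] conjunct2[OF c]])
    then have "(\<Sum>b\<in>B. scale (c b - c' b) b) \<in> U"
      by (simp add: scale_left_diff_distrib sum_subtractf)
    then have "c b - c' b = 0" if "b \<in> B" for b using indep[OF that, of "\<lambda>b. c b - c' b"] by simp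
    with c c' show "c = c'" by (metis eq_iff_diff_eq_0 ext)
  qed (use B finB in \<open>auto simp: spanning_def\<close>)
  then show ?thesis ..
qed

lemma card_cosets_quotient_basis:
  fixes scale :: "'k::{field,finite} \<Rightarrow> 'v::ab_group_add \<Rightarrow> 'v"
  assumes "vector_space scale" and U: "module.subspace scale U" and B: "quotient_basis scale U B"
  shows "card (cosets U) = CARD('k) ^ card B"
proof -
  interpret vector_space scale by fact
  have finB: "finite B"
    and unique: "\<And>v. \<exists>!c. (\<forall>b. b \<notin> B \<longrightarrow> c b = 0) \<and> v - (\<Sum>b\<in>B. scale (c b) b) \<in> U"
    using B by (auto simp: quotient_basis_def)
  have "card (cosets U) = card {c. \<forall>b. b \<notin> B \<longrightarrow> c b = (0::'k)}"
  proof (rule card_cosets[where \<rho> = "\<lambda>c. \<Sum>b\<in>B. scale (c b) b"])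
    fix c c' :: "'v \<Rightarrow> 'k"
    assume "c \<in> {c. \<forall>b. b \<notin> B \<longrightarrow> c b = 0}" "c' \<in> {c. \<forall>b. b \<notin> B \<longrightarrow> c b = 0}"
      and "(\<Sum>b\<in>B. scale (c b) b) - (\<Sum>b\<in>B. scale (c' b) b) \<in> U"
    moreover have "(\<Sum>b\<in>B. scale (c b) b) - (\<Sum>b\<in>B. scale (c b) b) \<in> U"
      using subspace_0[OF U] by simp
    ultimately show "c = c'"
      using unique[of "\<Sum>b\<in>B. scale (c b) b"] by blast
  next
    fix f show "\<exists>c\<in>{c. \<forall>b. b \<notin> B \<longrightarrow> c b = 0}. f - (\<Sum>b\<in>B. scale (c b) b) \<in> U"
      using unique[of f] by blast
  qed (use subspace_0[OF U] subspace_diff[OF U] in auto)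
  then show ?thesis by (simp add: card_supported_functions[OF finB])
qed

text \<open>Every basis B gives q^(card B) cosets, so all bases have n elements and the description
  in \<open>quotient_dim\<close> is well-defined.\<close>

lemma quotient_dim_eq:
  fixes scale :: "'k::{field,finite} \<Rightarrow> 'v::ab_group_add \<Rightarrow> 'v"
  assumes "vector_space scale" "module.subspace scale U" and card: "card (cosets U) = CARD('k) ^ n"
  shows "quotient_dim scale U = n"
proof -
  have "CARD('k) > 1"
    using card_mono[of UNIV "{0, 1 :: 'k}"] by simp
  then have card_eq: "card B = n" if "quotient_basis scale U B" for B
    using card_cosets_quotient_basis[OF assms(1,2) that] card by (simp add: power_inject_exp)
  have "finite (cosets U)" by (rule card_ge_0_finite) (simp add: card)
  then obtain B where "quotient_basis scale U B"
    using quotient_basis_ex[OF assms(1,2)] by blast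
  with card_eq show ?thesis
    unfolding quotient_dim_def by (intro the_equality) auto
qed

lemma log_card_quotient_eq:
  assumes "q > 1" "card (cosets U) = q ^ n"
  shows "log_card_quotient q U = n"
  using assms by (simp add: log_card_quotient_def log_nat_power)

section \<open>The two rings\<close>

lemma fps_X_dvd_iff: "fps_X dvd f \<longleftrightarrow> f $ 0 = (0::'a::comm_ring_1)"
proof
  assume "f $ 0 = 0"
  then have "f = fps_X * fps_shift 1 f"
    by (simp add: fps_eq_iff)
  then show "fps_X dvd f" by (rule dvdI)
qed auto

text \<open>Divisibility by the variable is vanishing of the constant term, so all axioms reduce to
  the coefficient field.\<close>

lemma uniformizer_fps: "uniformizer (fps_X :: 'a::finite_field fps) (range fps_const)"
proof
  fix f :: "'a fps"
  show "f = 0" if "fps_X * f = 0"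
    using that by (auto simp: fps_eq_iff dest: spec[of _ "Suc _"])
  show "\<exists>g. fps_X dvd f * g - 1" if "\<not> fps_X dvd f"
    using that by (intro exI[of _ "fps_const (inverse (f $ 0))"]) (simp add: fps_X_dvd_iff)
  show "\<exists>d\<in>range fps_const. fps_X dvd f - d"
    by (intro bexI[of _ "fps_const (f $ 0)"]) (simp_all add: fps_X_dvd_iff)
qed (auto simp: fps_X_dvd_iff)

definition teichmueller :: "'a::zero \<Rightarrow> 'a witt" where
  "teichmueller a = Abs_witt (\<lambda>n. if n = 0 then a else 0)"

lemma witt_nth_teichmueller [simp]: "witt_nth (teichmueller a) 0 = a"
  by (simp add: teichmueller_def witt_inverse)

lemma inj_teichmueller: "inj teichmueller"
  by (metis injI witt_nth_teichmueller)

text \<open>Divisibility by p is vanishing of coordinate 0, a ring homomorphism to the field;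
  inverses modulo p are Teichmueller lifts of inverses there.\<close>

lemma uniformizer_witt:
  "uniformizer (of_nat CHAR('a) :: 'a::finite_field witt) (range teichmueller)"
proof
  fix a :: "'a witt"
  show "a = 0" if "of_nat CHAR('a) * a = 0"
    using that by (simp only: witt_char_mult_eq_0_iff)
  show "\<exists>b. of_nat CHAR('a) dvd a * b - 1" if "\<not> of_nat CHAR('a) dvd a"
    using that by (intro exI[of _ "teichmueller (inverse (witt_nth a 0))"])
      (simp add: witt_char_dvd_iff witt_nth_0_diff witt_nth_0_mult witt_nth_1)
  show "\<exists>d\<in>range teichmueller. of_nat CHAR('a) dvd a - d"
    by (intro bexI[of _ "teichmueller (witt_nth a 0)"])
      (simp_all add: witt_char_dvd_iff witt_nth_0_diff)
qed (auto simp: witt_char_dvd_iff witt_nth_0_diff witt_nth_1)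

lemma vector_space_scale2: "vector_space (scale2 :: 'a::field \<Rightarrow> _)"
  by unfold_locales (simp_all add: scale2_def algebra_simps flip: fps_const_add fps_const_mult)

lemma I_lambda_eq: "I_lambda A B C = ideal_generated (diagram_gens fps_X A B C)"
  by (simp add: I_lambda_def diagram_gens_def X2_def Y2_def fps_const_power mult.commute)

lemma WI_lambda_eq:
  "WI_lambda A B C = ideal_generated (diagram_gens (of_nat CHAR('a::comm_ring_prime_char)) A B C
    :: 'a witt fps set)"
  by (simp add: WI_lambda_def diagram_gens_def Let_def fps_const_power flip: fps_of_nat)

section \<open>Comparison of the two sums\<close>

theorem theoremB1:
  fixes A B C :: nat
  assumes "A \<ge> B" "B \<ge> C"
  shows "(\<Sum>I | is_ideal I \<and> I_lambda A B C \<subseteq> (I :: 'a::finite_field fps fps set).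
            monom (1::int) (quotient_dim scale2 I))
       = (\<Sum>J | is_ideal J \<and> WI_lambda A B C \<subseteq> (J :: 'a witt fps set).
            monom (1::int) (log_card_quotient CARD('a) J))"
proof -
  interpret F: uniformizer "fps_X :: 'a fps" "range fps_const" by (rule uniformizer_fps)
  interpret W: uniformizer "of_nat CHAR('a) :: 'a witt" "range teichmueller" by (rule uniformizer_witt)
  interpret V: vector_space "scale2 :: 'a \<Rightarrow> _" by (rule vector_space_scale2)
  have cardF: "card (range (fps_const :: 'a \<Rightarrow> _)) = CARD('a)"
    by (intro card_image injI) simp
  have cardW: "card (range (teichmueller :: 'a \<Rightarrow> _)) = CARD('a)"
    by (intro card_image inj_teichmueller)
  have "(\<Sum>I | is_ideal I \<and> I_lambda A B C \<subseteq> (I :: 'a fps fps set).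
      monom (1::int) (quotient_dim scale2 I)) =
      (\<Sum>I | is_ideal I \<and> diagram_gens fps_X A B C \<subseteq> (I :: 'a fps fps set).
      monom (1::int) (quotient_dim scale2 I))"
    by (intro sum.cong Collect_cong refl conj_cong) (simp only: I_lambda_eq ideal_generated_subset_iff)
  also have "\<dots> = hermite_sum CARD('a) A B C"
    unfolding cardF[symmetric]
  proof (rule F.sum_ideals_eq_hermite_sum)
    fix J :: "'a fps fps set" and n
    assume J: "is_ideal J" and card: "card (cosets J) = card (range (fps_const :: 'a \<Rightarrow> _)) ^ n"
    \<comment> \<open>Scalars act as multiplication by constant series, so ideals are subspaces and
      their colength is a dimension.\<close>
    from J have "V.subspace J"
      unfolding is_ideal_iff V.subspace_def by (simp add: scale2_def)
    with card show "quotient_dim scale2 J = n"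
      by (intro quotient_dim_eq[OF vector_space_scale2]) (simp_all add: cardF)
  qed
  \<comment> \<open>The same polynomial arises over the Witt vectors, since both digit sets have q
    elements.\<close>
  also have "\<dots> = (\<Sum>J | is_ideal J \<and> diagram_gens (of_nat CHAR('a)) A B C \<subseteq> (J :: 'a witt fps set).
      monom (1::int) (log_card_quotient CARD('a) J))"
    unfolding cardW[symmetric]
    by (intro W.sum_ideals_eq_hermite_sum[symmetric] log_card_quotient_eq W.card_digits_gt_1)
  also have "\<dots> = (\<Sum>J | is_ideal J \<and> WI_lambda A B C \<subseteq> (J :: 'a witt fps set).
      monom (1::int) (log_card_quotient CARD('a) J))"
    by (intro sum.cong Collect_cong refl conj_cong) (simp only: WI_lambda_eq ideal_generated_subset_iff)
  finally show ?thesis .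
qed

end
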